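(* Let $k\ge2$ and $n\ge1$, let $S_k$ act on $[k]^n$ by $(g\cdot x)_i=g(x_i)$, let $K_n$ be the classical Burnside kernel on $[k]^n$, $Q_n$ the dual Burnside kernel on $S_k^*$, and $\bar Q_n^{\mathrm{fs}}$ the lumping of $Q_n$ by the fixed-symbol-set blocks $E_S$, $S\in\mathcal B_k$ (where $|\mathcal B_k|=2^k-k-1$). For $S,T\in\mathcal B_k$, set $j:=|S\cap T|$. Then $$\bar Q_n^{\mathrm{fs}}(S,T)={!}(k-|T|)\,\frac1{|S|^n}\sum_{m=1}^{\min\{j,n\}}\binom jmS(n,m)\frac{m!}{(k-m)!}$$ $$={!}(k-|T|)\left(\frac j{|S|}\right)^n\mathbb E\big[(k-R_{j,n})!^{-1}\big]={!}(k-|T|)\,\frac{n!}{|S|^n}[u^n][z^k]\,e^z(1+z(e^u-1))^j,$$ where the second formula is interpreted as $0$ when $j=0$. The stationary law is $$\bar\pi_{Q,n}^{\mathrm{fs}}(S)=\frac{{!}(k-|S|)\,|S|^n}{k!\,Z_{k,n}}.$$ Moreover, $$\mathrm{Spec}_{\ne0}(K_n)=\mathrm{Spec}_{\ne0}(Q_n)=\mathrm{Spec}_{\ne0}(\bar Q_n^{\mathrm{fs}}),\qquad \mathrm{rank}(K_n)=\mathrm{rank}(Q_n)\le2^k-k-1,$$ with matching algebraic multiplicities, and $$\det(\lambda I_{S_k^*}-Q_n)=\lambda^{|S_k^*|-|\mathcal B_k|}\det(\lambda I_{\mathcal B_k}-\bar Q_n^{\mathrm{fs}}).$$ If $g\in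 E_S$, then for integers $t\ge1$, $$d_{Q_n}(g,t)=d_{\bar Q_n^{\mathrm{fs}}}(S,t),\qquad d_{Q_n}(t)=\max_{S\in\mathcal B_k}d_{\bar Q_n^{\mathrm{fs}}}(S,t).$$
   Context: $[k]=\{1,\dots,k\}$; $\mathrm{Fix}(g)=\{a\in[k]:g(a)=a\}$; $S(n,m)$ is the Stirling number of the second kind; ${!}m$ is the number of derangements of $m$ symbols (${!}0=1$); $Z_{k,n}:=\sum_{r=0}^{\min\{k,n\}}S(n,r)$; $[u^n]$, $[z^k]$ denote coefficient extraction. For $j\ge1$, $R_{j,n}$ is the number of distinct symbols used by a uniform random word in $[j]^n$. For $G=S_k$ acting on $X=[k]^n$: $X_g=\{x:g\cdot x=x\}=\mathrm{Fix}(g)^n$, $G_x=\{g:g\cdot x=x\}$, $S_k^*=\{g\in S_k:\mathrm{Fix}(g)\ne\varnothing\}$, $K_n(x,y)=\frac1{|G_x|}\sum_{g\in G_x\cap G_y}\frac1{|X_g|}$ on $X$, and $Q_n(g,h)=\frac1{|X_g|}\sum_{x\in X_g\cap X_h}\frac1{|G_x|}$ on $S_k^*$, with stationary law $\pi_Q(g)=|\mathrm{Fix}(g)|^n/(k!Z_{k,n})$. $E_S:=\{g\in S_k^*:\mathrm{Fix}(g)=S\}$ for $S\subseteq[k]$; it is nonempty exactly when $S\in\mathcal B_k:=\{S\subseteq[k]:S\ne\varnothing,\ |S|\ne k-1\}$. The kernel $Q_n$ is strongly lumpable with respect to the partition $\{E_S\}_{S\in\mathcal B_k}$ of $S_k^*$;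 the lumped kernel is $\bar Q_n^{\mathrm{fs}}(S,T)=\sum_{h\in E_T}Q_n(g,h)$ for any $g\in E_S$, and its stationary law is the pushforward of $\pi_Q$. For a kernel $P$ with stationary law $\pi$, $d_P(s,t):=\|P^t(s,\cdot)-\pi\|_{\mathrm{TV}}$ with $\|\mu-\nu\|_{\mathrm{TV}}=\frac12\sum_s|\mu(s)-\nu(s)|$, and $d_P(t):=\max_sd_P(s,t)$. $\mathrm{Spec}_{\ne0}$ denotes nonzero eigenvalues. *)

theory Defs
  imports
    "HOL-Combinatorics.Stirling"
    "HOL-Computational_Algebra.Formal_Power_Series"
    "HOL-Probability.Probability_Mass_Function"
    "Jordan_Normal_Form.Char_Poly"
    "Jordan_Normal_Form.Spectral_Radius"
    "Jordan_Normal_Form.DL_Rank"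
begin

section \<open>The action of the symmetric group on words\<close>

definition sym_grp :: "nat \<Rightarrow> (nat \<Rightarrow> nat) set" where
  "sym_grp k = {g. g permutes {1..k}}"

definition fix_set :: "nat \<Rightarrow> (nat \<Rightarrow> nat) \<Rightarrow> nat set" where
  "fix_set k g = {a \<in> {1..k}. g a = a}"

text \<open>The word space \<open>[k]^n\<close>, as lists of length \<open>n\<close>; \<open>g\<close> acts on a word by \<^term>\<open>map g\<close>.\<close>

definition words :: "nat \<Rightarrow> nat \<Rightarrow> nat list set" where
  "words k n = {x. length x = n \<and> set x \<subseteq> {1..k}}"

definition fixed_words :: "nat \<Rightarrow> nat \<Rightarrow> (nat \<Rightarrow> nat) \<Rightarrow> nat list set" where
  "fixed_words k n g = {x \<in> words k n. map g x = x}"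

definition stabilizer :: "nat \<Rightarrow> nat list \<Rightarrow> (nat \<Rightarrow> nat) set" where
  "stabilizer k x = {g \<in> sym_grp k. map g x = x}"

definition sym_grp_star :: "nat \<Rightarrow> (nat \<Rightarrow> nat) set" where
  "sym_grp_star k = {g \<in> sym_grp k. fix_set k g \<noteq> {}}"

definition derangements :: "nat \<Rightarrow> nat" where
  "derangements m = card {p. p permutes {1..m} \<and> (\<forall>i\<in>{1..m}. p i \<noteq> i)}"

definition Z_norm :: "nat \<Rightarrow> nat \<Rightarrow> nat" where
  "Z_norm k n = (\<Sum>r=0..min k n. Stirling n r)"


section \<open>The Burnside kernels\<close>

definition burnside_kernel :: "nat \<Rightarrow> nat \<Rightarrow> nat list \<Rightarrow> nat list \<Rightarrow> real" where
  "burnside_kernel k n x y =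
     1 / real (card (stabilizer k x)) *
       (\<Sum>g \<in> stabilizer k x \<inter> stabilizer k y. 1 / real (card (fixed_words k n g)))"

definition dual_kernel :: "nat \<Rightarrow> nat \<Rightarrow> (nat \<Rightarrow> nat) \<Rightarrow> (nat \<Rightarrow> nat) \<Rightarrow> real" where
  "dual_kernel k n g h =
     1 / real (card (fixed_words k n g)) *
       (\<Sum>x \<in> fixed_words k n g \<inter> fixed_words k n h. 1 / real (card (stabilizer k x)))"

definition dual_law :: "nat \<Rightarrow> nat \<Rightarrow> (nat \<Rightarrow> nat) \<Rightarrow> real" where
  "dual_law k n g = real (card (fix_set k g)) ^ n / (fact k * real (Z_norm k n))"


section \<open>Finite-state kernels: lumping, stationarity, distance to stationarity\<close>

definition strongly_lumpable :: "'a set \<Rightarrow> ('a \<Rightarrow> 'a \<Rightarrow> real) \<Rightarrow> 'a set set \<Rightarrow> bool" where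
  "strongly_lumpable A P \<P> \<longleftrightarrow> partition_on A \<P> \<and>
     (\<forall>C\<in>\<P>. \<forall>D\<in>\<P>. \<forall>s\<in>C. \<forall>s'\<in>C. (\<Sum>t\<in>D. P s t) = (\<Sum>t\<in>D. P s' t))"

text \<open>The representative of the block \<open>C\<close> is immaterial when the kernel is strongly lumpable
  with respect to a partition containing \<open>C\<close> and \<open>D\<close>.\<close>

definition lumped :: "('a \<Rightarrow> 'a \<Rightarrow> real) \<Rightarrow> 'a set \<Rightarrow> 'a set \<Rightarrow> real" where
  "lumped P C D = (\<Sum>t\<in>D. P (SOME s. s \<in> C) t)"

definition stationary_law :: "'a set \<Rightarrow> ('a \<Rightarrow> 'a \<Rightarrow> real) \<Rightarrow> ('a \<Rightarrow> real) \<Rightarrow> bool" where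
  "stationary_law A P \<mu> \<longleftrightarrow> (\<forall>s\<in>A. 0 \<le> \<mu> s) \<and> (\<Sum>s\<in>A. \<mu> s) = 1 \<and>
     (\<forall>t\<in>A. (\<Sum>s\<in>A. \<mu> s * P s t) = \<mu> t)"

fun kernel_pow :: "'a set \<Rightarrow> ('a \<Rightarrow> 'a \<Rightarrow> real) \<Rightarrow> nat \<Rightarrow> 'a \<Rightarrow> 'a \<Rightarrow> real" where
  "kernel_pow A P 0 s u = (if s = u then 1 else 0)"
| "kernel_pow A P (Suc t) s u = (\<Sum>v\<in>A. P s v * kernel_pow A P t v u)"

definition tv_dist :: "'a set \<Rightarrow> ('a \<Rightarrow> real) \<Rightarrow> ('a \<Rightarrow> real) \<Rightarrow> real" where
  "tv_dist A \<mu> \<nu> = 1 / 2 * (\<Sum>s\<in>A. \<bar>\<mu> s - \<nu> s\<bar>)"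

definition mix_dist ::
  "'a set \<Rightarrow> ('a \<Rightarrow> 'a \<Rightarrow> real) \<Rightarrow> ('a \<Rightarrow> real) \<Rightarrow> 'a \<Rightarrow> nat \<Rightarrow> real" where
  "mix_dist A P \<pi> s t = tv_dist A (kernel_pow A P t s) \<pi>"

definition max_mix_dist ::
  "'a set \<Rightarrow> ('a \<Rightarrow> 'a \<Rightarrow> real) \<Rightarrow> ('a \<Rightarrow> real) \<Rightarrow> nat \<Rightarrow> real" where
  "max_mix_dist A P \<pi> t = Max ((\<lambda>s. mix_dist A P \<pi> s t) ` A)"

text \<open>A kernel on a finite set \<open>A\<close> as a square matrix. The enumeration \<^term>\<open>from_nat_into A\<close> is a
  bijection from \<open>{..<card A}\<close> onto \<open>A\<close>; the choice of enumeration changes the matrix only by a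
  simultaneous permutation of rows and columns, hence does not affect spectrum, multiplicities,
  rank or determinants.\<close>

definition kernel_mat :: "'a set \<Rightarrow> ('a \<Rightarrow> 'a \<Rightarrow> real) \<Rightarrow> real mat" where
  "kernel_mat A P =
     Matrix.mat (card A) (card A) (\<lambda>(i, j). P (from_nat_into A i) (from_nat_into A j))"

definition kernel_cmat :: "'a set \<Rightarrow> ('a \<Rightarrow> 'a \<Rightarrow> real) \<Rightarrow> complex mat" where
  "kernel_cmat A P = map_mat complex_of_real (kernel_mat A P)"

definition spec_nz :: "complex mat \<Rightarrow> complex set" where
  "spec_nz M = spectrum M - {0}"

definition alg_mult :: "complex mat \<Rightarrow> complex \<Rightarrow> nat" where
  "alg_mult M z = Polynomial.order z (char_poly M)"

definition mat_rank :: "real mat \<Rightarrow> nat" where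
  "mat_rank M = vec_space.rank (dim_row M) M"


section \<open>The lumping of the dual kernel by fixed-symbol sets\<close>

definition fs_block :: "nat \<Rightarrow> nat set \<Rightarrow> (nat \<Rightarrow> nat) set" where
  "fs_block k S = {g \<in> sym_grp_star k. fix_set k g = S}"

definition fs_index :: "nat \<Rightarrow> nat set set" where
  "fs_index k = {S. S \<subseteq> {1..k} \<and> S \<noteq> {} \<and> card S \<noteq> k - 1}"

definition fs_kernel :: "nat \<Rightarrow> nat \<Rightarrow> nat set \<Rightarrow> nat set \<Rightarrow> real" where
  "fs_kernel k n S T = lumped (dual_kernel k n) (fs_block k S) (fs_block k T)"

text \<open>The pushforward of the law of the dual chain.\<close>

definition fs_law :: "nat \<Rightarrow> nat \<Rightarrow> nat set \<Rightarrow> real" where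
  "fs_law k n S = (\<Sum>g\<in>fs_block k S. dual_law k n g)"


section \<open>The bivariate generating function\<close>

text \<open>Power series in \<open>z\<close> whose coefficients are power series in \<open>u\<close>; thus \<open>[u^n][z^k] F\<close> is
  \<open>fps_nth (fps_nth F k) n\<close>. Here \<open>exp_z\<close> and \<open>exp_u\<close> are \<open>e^z\<close> and \<open>e^u\<close>.\<close>

definition exp_z :: "real fps fps" where
  "exp_z = Abs_fps (\<lambda>i. fps_const (1 / fact i))"

definition exp_u :: "real fps fps" where
  "exp_u = fps_const (fps_exp 1)"

definition fs_gf :: "nat \<Rightarrow> real fps fps" where
  "fs_gf j = exp_z * (1 + fps_X * (exp_u - 1)) ^ j"

end

theory Submission
  imports Defs
begin

text \<open>
  Both Burnside kernels come from the incidence relation ``\<open>g\<close> fixes \<open>x\<close>'': if \<open>f\<close> is this relation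
  divided by \<open>|G_x|\<close> and \<open>f'\<close> its transpose divided by \<open>|X_g|\<close>, then \<open>K = f f'\<close> and \<open>Q = f' f\<close>.
  Likewise \<open>Q(g,h)\<close> depends only on the fixed-point sets of \<open>g\<close> and \<open>h\<close>, so \<open>Q = U V\<close> with \<open>U\<close> the
  block indicator, and the lumped kernel is \<open>V U\<close>. Nonzero spectra, multiplicities and
  characteristic polynomials are then compared by Sylvester's identity for \<open>A B\<close> and \<open>B A\<close>. Ranks
  are not invariant under this exchange in general; here they agree because \<open>f\<close> and \<open>f'\<close> are
  transposes of each other up to positive weights, so that \<open>f f'\<close> and \<open>f'\<close> have the same kernel.
  After one step the law of the dual chain is constant on blocks, hence total variation distances
  are preserved by the lumping. The explicit entries count words by their set of symbols.
\<close>

unbundle no vec_syntax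

section \<open>Exchanging the factors of a matrix product\<close>

text \<open>Both sides are \<open>c ^ n\<close> times the determinant of the block matrix with rows \<open>(c, A)\<close> and \<open>(B, 1)\<close>.\<close>

lemma det_sylvester:
  fixes A B :: "'a :: idom mat" and c :: 'a
  assumes A: "A \<in> carrier_mat m n" and B: "B \<in> carrier_mat n m"
  shows "c ^ n * Determinant.det (c \<cdot>\<^sub>m 1\<^sub>m m - A * B) = c ^ m * Determinant.det (c \<cdot>\<^sub>m 1\<^sub>m n - B * A)"
proof -
  define M where "M = four_block_mat (c \<cdot>\<^sub>m 1\<^sub>m m) A B (1\<^sub>m n)"
  define L where "L = four_block_mat (1\<^sub>m m) (- A) (0\<^sub>m n m) (1\<^sub>m n)"
  define L' where "L' = four_block_mat (1\<^sub>m m) (0\<^sub>m m n) (- B) (c \<cdot>\<^sub>m 1\<^sub>m n)"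
  have carr: "M \<in> carrier_mat (m + n) (m + n)" "L \<in> carrier_mat (m + n) (m + n)"
      "L' \<in> carrier_mat (m + n) (m + n)"
    using A B by (auto simp: M_def L_def L'_def)
  have detL: "Determinant.det L = 1"
    unfolding L_def by (subst det_four_block_mat_lower_left_zero) (use A in auto)
  have detL': "Determinant.det L' = c ^ n"
    unfolding L'_def by (subst det_four_block_mat_upper_right_zero) (use B in auto)
  have AB: "A * B \<in> carrier_mat m m" and BA: "B * A \<in> carrier_mat n n"
    using A B by auto
  have "L * M = four_block_mat (c \<cdot>\<^sub>m 1\<^sub>m m - A * B) (0\<^sub>m m n) B (1\<^sub>m n)"
    unfolding L_def M_def using A B AB
    by (subst mult_four_block_mat[where ?nr1.0 = m and ?nr2.0 = n and ?n1.0 = m and ?n2.0 = n])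
       (auto intro!: arg_cong4[of _ _ _ _ _ _ _ _ four_block_mat] simp: add_uminus_minus_mat)
  then have "Determinant.det (L * M) = Determinant.det (c \<cdot>\<^sub>m 1\<^sub>m m - A * B)"
    by simp (subst det_four_block_mat_upper_right_zero, use A B AB in auto)
  then have M1: "Determinant.det M = Determinant.det (c \<cdot>\<^sub>m 1\<^sub>m m - A * B)"
    using det_mult[OF carr(2,1)] detL by simp
  have "L' * M = four_block_mat (c \<cdot>\<^sub>m 1\<^sub>m m) A (0\<^sub>m n m) (c \<cdot>\<^sub>m 1\<^sub>m n - B * A)"
    unfolding L'_def M_def using A B BA
    by (subst mult_four_block_mat[where ?nr1.0 = m and ?nr2.0 = n and ?n1.0 = m and ?n2.0 = n])
       (auto intro!: arg_cong4[of _ _ _ _ _ _ _ _ four_block_mat])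
  then have "Determinant.det (L' * M) = c ^ m * Determinant.det (c \<cdot>\<^sub>m 1\<^sub>m n - B * A)"
    by simp (subst det_four_block_mat_lower_left_zero, use A B BA in auto)
  then have "c ^ n * Determinant.det M = c ^ m * Determinant.det (c \<cdot>\<^sub>m 1\<^sub>m n - B * A)"
    using det_mult[OF carr(3,1)] detL' by simp
  then show ?thesis by (simp add: M1)
qed

section \<open>Characteristic polynomials of products\<close>

lemma char_poly_matrix_eq_minus:
  fixes A :: "'a :: comm_ring_1 mat"
  assumes "A \<in> carrier_mat n n"
  shows "char_poly_matrix A = [:0, 1:] \<cdot>\<^sub>m 1\<^sub>m n - map_mat (\<lambda>a. [:a:]) A"
  unfolding char_poly_matrix_def using assms by (intro eq_matI) auto

text \<open>Sylvester's identity over the polynomial ring, with the indeterminate in the role of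
  \<open>c\<close>. The two monomials compensate for the different sizes of the products.\<close>

lemma char_poly_mult_commute:
  fixes A B :: "'a :: idom mat"
  assumes A: "A \<in> carrier_mat m n" and B: "B \<in> carrier_mat n m"
  shows "monom 1 n * char_poly (A * B) = monom 1 m * char_poly (B * A)"
proof -
  let ?h = "map_mat (\<lambda>a. [:a:])"
  have "[:0, 1:] ^ n * Determinant.det ([:0, 1:] \<cdot>\<^sub>m 1\<^sub>m m - ?h A * ?h B)
      = [:0, 1:] ^ m * Determinant.det ([:0, 1:] \<cdot>\<^sub>m 1\<^sub>m n - ?h B * ?h A)"
    using A B by (intro det_sylvester) auto
  moreover have "?h A * ?h B = ?h (A * B)" "?h B * ?h A = ?h (B * A)"
    using map_poly_mult(1)[OF A B] map_poly_mult(1)[OF B A] by auto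
  ultimately show ?thesis
    using A B unfolding char_poly_def
    by (simp add: char_poly_matrix_eq_minus[of "A * B" m] char_poly_matrix_eq_minus[of "B * A" n]
        monom_altdef)
qed

text \<open>A monomial vanishes only at 0, so at \<open>z \<noteq> 0\<close> the monomial factors in
  \<open>char_poly_mult_commute\<close> contribute nothing to the order.\<close>

lemma order_char_poly_mult_commute:
  fixes A B :: "'a :: field mat"
  assumes A: "A \<in> carrier_mat m n" and B: "B \<in> carrier_mat n m" and z: "z \<noteq> 0"
  shows "Polynomial.order z (char_poly (A * B)) = Polynomial.order z (char_poly (B * A))"
proof -
  have monic: "char_poly (A * B) \<noteq> 0" "char_poly (B * A) \<noteq> 0"
    using degree_monic_char_poly[of "A * B" m] degree_monic_char_poly[of "B * A" n] A B by auto
  have ord: "Polynomial.order z (monom 1 d) = 0" for d :: nat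
    using z by (intro order_0I) (simp add: poly_monom)
  have "Polynomial.order z (monom 1 n * char_poly (A * B)) = Polynomial.order z (monom 1 m * char_poly (B * A))"
    by (simp add: char_poly_mult_commute[OF A B])
  then show ?thesis
    using monic by (simp add: order_mult ord)
qed

lemma eigenvalue_iff_order:
  fixes A :: "'a :: field mat"
  assumes "A \<in> carrier_mat n n"
  shows "eigenvalue A z \<longleftrightarrow> Polynomial.order z (char_poly A) \<noteq> 0"
  using degree_monic_char_poly[OF assms]
  by (auto simp: eigenvalue_root_char_poly[OF assms] order_root)

lemma poly_char_poly:
  fixes A :: "'a :: field mat"
  assumes A: "A \<in> carrier_mat n n"
  shows "poly (char_poly A) z = Determinant.det (z \<cdot>\<^sub>m 1\<^sub>m n - A)"
proof -
  have "- char_matrix A z = z \<cdot>\<^sub>m 1\<^sub>m n - A"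
    using A by (intro eq_matI) (auto simp: char_matrix_def)
  then show ?thesis using char_poly_matrix[OF A] by simp
qed

section \<open>Ranks of products\<close>

lemma rank_mult_le:
  fixes A B :: "'a :: field mat"
  assumes A: "A \<in> carrier_mat n m" and B: "B \<in> carrier_mat m p"
  shows "vec_space.rank n (A * B) \<le> vec_space.rank n A"
proof -
  interpret vec_space "TYPE('a)" n .
  have AB: "A * B \<in> carrier_mat n p" using A B by auto
  \<comment> \<open>The rank of \<open>A * B\<close> is the size of a maximal independent set of its
    columns. Each such column is \<open>A\<close> applied to a column of \<open>B\<close>, so the
    whole set lies in the column space of \<open>A\<close>, whose dimension bounds its size.\<close>
  obtain U where U: "maximal U (\<lambda>T. T \<subseteq> set (cols (A * B)) \<and> lin_indpt T)"
    using maximal_exists_superset[of "set (cols (A * B))" "\<lambda>T. T \<subseteq> set (cols (A * B)) \<and> lin_indpt T" "{}"]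
    by (auto simp: lin_dep_def)
  then have Us: "U \<subseteq> set (cols (A * B))" and Ui: "lin_indpt U"
    by (auto simp: maximal_def)
  have cA: "set (cols A) \<subseteq> carrier_vec n"
    using A cols_dim by blast
  have sub: "U \<subseteq> span (set (cols A))"
  proof
    fix u assume "u \<in> U"
    then obtain j where j: "j < p" "u = col (A * B) j"
      using Us B by (auto simp: cols_def)
    then have "u = A *\<^sub>v col B j" using A B by auto
    moreover have "col B j \<in> carrier_vec m" using B j by auto
    ultimately show "u \<in> span (set (cols A))"
      using col_space_eq[OF A] A unfolding col_space_def by auto
  qed
  have subm: "submodule class_ring (span (set (cols A))) V"
    using cA span_is_submodule by auto
  interpret S: vectorspace class_ring "vs (span (set (cols A)))"
    using cA span_is_subspace subspace_is_vs by simp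
  have "S.lin_indpt U"
    using span_li_not_depend(2)[OF sub subm] Ui by simp
  then have "card U \<le> S.dim"
    using sub fin_dim_span_cols[OF A] by (intro S.li_le_dim(2)) auto
  then show ?thesis
    using rank_card_indpt[OF AB U] by (simp add: rank_def)
qed

text \<open>Rank-nullity: both maps start from the same space of dimension \<open>m\<close>, so each
  rank is \<open>m\<close> minus the dimension of the common kernel.\<close>

lemma rank_eq_if_same_kernel:
  fixes A B :: "'a :: field mat"
  assumes A: "A \<in> carrier_mat n m" and B: "B \<in> carrier_mat p m"
    and ker: "\<And>v. v \<in> carrier_vec m \<Longrightarrow> A *\<^sub>v v = 0\<^sub>v n \<longleftrightarrow> B *\<^sub>v v = 0\<^sub>v p"
  shows "vec_space.rank n A = vec_space.rank p B"
proof -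
  let ?V = "module_vec TYPE('a) m"
  interpret V: vec_space "TYPE('a)" m .
  have *: "vec_space.rank k C + vectorspace.dim class_ring
      (V.vs {v \<in> carrier_vec m. C *\<^sub>v v = 0\<^sub>v k}) = m" if C: "C \<in> carrier_mat k m" for C :: "'a mat" and k
  proof -
    interpret W: vec_space "TYPE('a)" k .
    interpret T: linear_map class_ring ?V "module_vec TYPE('a) k" "\<lambda>v. C *\<^sub>v v"
      by unfold_locales (use C in \<open>auto simp: module_hom_def module_vec_def mult_add_distrib_mat_vec mult_mat_vec\<close>)
    have "T.imT = W.span (set (cols C))"
      using W.col_space_eq[OF C] C unfolding W.col_space_def T.im_def by (auto simp: module_vec_def)
    moreover have "T.kerT = {v \<in> carrier_vec m. C *\<^sub>v v = 0\<^sub>v k}"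
      unfolding T.ker_def by (auto simp: module_vec_def)
    ultimately show ?thesis
      using T.rank_nullity V.fin_dim V.dim_is_n unfolding W.rank_def by simp
  qed
  have "{v \<in> carrier_vec m. A *\<^sub>v v = 0\<^sub>v n} = {v \<in> carrier_vec m. B *\<^sub>v v = 0\<^sub>v p}"
    using ker by auto
  then show ?thesis using *[OF A] *[OF B] by simp
qed

text \<open>The hypothesis makes \<open>F\<close> and \<open>G\<close> adjoint for the inner
  products weighted by \<alpha> and \<beta>. The identity reads <v, FGv> = <Gv, Gv> in these
  products.\<close>

lemma scalar_prod_weighted_transpose:
  fixes F G :: "real mat"
  assumes F: "F \<in> carrier_mat m n" and G: "G \<in> carrier_mat n m"
    and FG: "\<And>i j. i < m \<Longrightarrow> j < n \<Longrightarrow> \<alpha> i * F $$ (i, j) = \<beta> j * G $$ (j, i)"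
    and v: "v \<in> carrier_vec m"
  shows "(\<Sum>i<m. \<alpha> i * v $ i * ((F * G) *\<^sub>v v) $ i) = (\<Sum>j<n. \<beta> j * ((G *\<^sub>v v) $ j)\<^sup>2)"
proof -
  define w where "w = G *\<^sub>v v"
  have w: "w \<in> carrier_vec n" using G v by (auto simp: w_def)
  have Gv: "w $ j = (\<Sum>i<m. G $$ (j, i) * v $ i)" if "j < n" for j
    using G v that by (auto simp: w_def scalar_prod_def atLeast0LessThan)
  have Fw: "((F * G) *\<^sub>v v) $ i = (\<Sum>j<n. F $$ (i, j) * w $ j)" if "i < m" for i
    using F G v w that unfolding w_def
    by (simp add: assoc_mult_mat_vec[OF F G v]) (auto simp: scalar_prod_def atLeast0LessThan)
  have "(\<Sum>i<m. \<alpha> i * v $ i * ((F * G) *\<^sub>v v) $ i) = (\<Sum>i<m. \<Sum>j<n. (\<alpha> i * F $$ (i, j)) * v $ i * w $ j)"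
    by (simp add: Fw sum_distrib_left mult_ac)
  also have "\<dots> = (\<Sum>i<m. \<Sum>j<n. (\<beta> j * G $$ (j, i)) * v $ i * w $ j)"
    by (intro sum.cong refl) (simp add: FG)
  also have "\<dots> = (\<Sum>j<n. \<Sum>i<m. (\<beta> j * G $$ (j, i)) * v $ i * w $ j)"
    by (rule sum.swap)
  also have "\<dots> = (\<Sum>j<n. \<beta> j * w $ j * (\<Sum>i<m. G $$ (j, i) * v $ i))"
    by (simp add: sum_distrib_left mult_ac)
  also have "\<dots> = (\<Sum>j<n. \<beta> j * (w $ j)\<^sup>2)"
    by (intro sum.cong refl) (simp add: Gv[symmetric] power2_eq_square)
  finally show ?thesis by (simp add: w_def)
qed

text \<open>If FGv = 0, the weighted square norm of Gv vanishes, and positive weights over the reals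
  force Gv = 0. So \<open>F * G\<close> and \<open>G\<close> have the same kernel.\<close>

lemma rank_mult_weighted_transpose:
  fixes F G :: "real mat"
  assumes F: "F \<in> carrier_mat m n" and G: "G \<in> carrier_mat n m"
    and FG: "\<And>i j. i < m \<Longrightarrow> j < n \<Longrightarrow> \<alpha> i * F $$ (i, j) = \<beta> j * G $$ (j, i)"
    and pos: "\<And>j. j < n \<Longrightarrow> \<beta> j > 0"
  shows "vec_space.rank m (F * G) = vec_space.rank n G"
proof (rule rank_eq_if_same_kernel)
  show "F * G \<in> carrier_mat m m" "G \<in> carrier_mat n m" using F G by auto
  fix v :: "real vec" assume v: "v \<in> carrier_vec m"
  show "F * G *\<^sub>v v = 0\<^sub>v m \<longleftrightarrow> G *\<^sub>v v = 0\<^sub>v n"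
  proof
    assume "G *\<^sub>v v = 0\<^sub>v n"
    then show "F * G *\<^sub>v v = 0\<^sub>v m"
      using F by (simp add: assoc_mult_mat_vec[OF F G v]) (auto simp: scalar_prod_def)
  next
    assume "F * G *\<^sub>v v = 0\<^sub>v m"
    then have "(\<Sum>j<n. \<beta> j * ((G *\<^sub>v v) $ j)\<^sup>2) = 0"
      using scalar_prod_weighted_transpose[where \<alpha> = \<alpha> and \<beta> = \<beta>, OF F G FG v] by simp
    then have "\<forall>j\<in>{..<n}. \<beta> j * ((G *\<^sub>v v) $ j)\<^sup>2 = 0"
      by (subst (asm) sum_nonneg_eq_0_iff) (use pos in \<open>auto simp: less_imp_le\<close>)
    then have zero: "(G *\<^sub>v v) $ j = 0" if "j < n" for j
    proof -
      have "\<beta> j * ((G *\<^sub>v v) $ j)\<^sup>2 = 0" using \<open>\<forall>j\<in>{..<n}. _\<close> that by blast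
      with pos[OF that] show ?thesis by simp
    qed
    show "G *\<^sub>v v = 0\<^sub>v n"
      using G v by (intro eq_vecI) (auto simp: zero simp del: index_mult_mat_vec)
  qed
qed

text \<open>Each product has the rank of its right factor, and its rank is at most that of its left
  factor. Hence rank(FG) <= rank(F) = rank(GF), and symmetrically.\<close>

lemma rank_mult_commute_weighted_transpose:
  fixes F G :: "real mat"
  assumes F: "F \<in> carrier_mat m n" and G: "G \<in> carrier_mat n m"
    and FG: "\<And>i j. i < m \<Longrightarrow> j < n \<Longrightarrow> \<alpha> i * F $$ (i, j) = \<beta> j * G $$ (j, i)"
    and pos: "\<And>i. i < m \<Longrightarrow> \<alpha> i > 0" "\<And>j. j < n \<Longrightarrow> \<beta> j > 0"
  shows "vec_space.rank m (F * G) = vec_space.rank n (G * F)"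
proof (rule antisym)
  have "vec_space.rank n (G * F) = vec_space.rank m F"
    by (rule rank_mult_weighted_transpose[where \<alpha> = \<beta> and \<beta> = \<alpha>, OF G F]) (auto simp: FG pos)
  then show "vec_space.rank m (F * G) \<le> vec_space.rank n (G * F)"
    using rank_mult_le[OF F G] by simp
  have "vec_space.rank m (F * G) = vec_space.rank n G"
    by (rule rank_mult_weighted_transpose[where \<alpha> = \<alpha> and \<beta> = \<beta>, OF F G]) (auto simp: FG pos)
  then show "vec_space.rank n (G * F) \<le> vec_space.rank m (F * G)"
    using rank_mult_le[OF G F] by simp
qed

section \<open>Factorized and lumped kernels\<close>

definition rect_mat :: "'a set \<Rightarrow> 'b set \<Rightarrow> ('a \<Rightarrow> 'b \<Rightarrow> real) \<Rightarrow> real mat" where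
  "rect_mat A B f =
     Matrix.mat (card A) (card B) (\<lambda>(i, j). f (from_nat_into A i) (from_nat_into B j))"

lemma rect_mat_carrier [simp]: "rect_mat A B f \<in> carrier_mat (card A) (card B)"
  by (simp add: rect_mat_def)

lemma from_nat_into_finite:
  assumes "finite A" "i < card A"
  shows "from_nat_into A i \<in> A"
  using assms by (intro from_nat_into) auto

lemma sum_from_nat_into:
  fixes f :: "'a \<Rightarrow> 'b :: comm_monoid_add"
  assumes "finite A"
  shows "(\<Sum>i<card A. f (from_nat_into A i)) = (\<Sum>a\<in>A. f a)"
  using bij_betw_from_nat_into_finite[OF assms] by (rule sum.reindex_bij_betw)

lemma kernel_mat_factorization:
  assumes fin: "finite A" "finite B"
    and P: "\<And>a a'. a \<in> A \<Longrightarrow> a' \<in> A \<Longrightarrow> P a a' = (\<Sum>b\<in>B. f a b * g b a')"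
  shows "kernel_mat A P = rect_mat A B f * rect_mat B A g"
proof (rule eq_matI)
  fix i j assume "i < dim_row (rect_mat A B f * rect_mat B A g)"
    and "j < dim_col (rect_mat A B f * rect_mat B A g)"
  then have ij: "i < card A" "j < card A" by (auto simp: rect_mat_def)
  then have "kernel_mat A P $$ (i, j) = (\<Sum>b\<in>B. f (from_nat_into A i) b * g b (from_nat_into A j))"
    using fin by (simp add: kernel_mat_def P from_nat_into_finite)
  also have "\<dots> = (\<Sum>l<card B. f (from_nat_into A i) (from_nat_into B l) * g (from_nat_into B l) (from_nat_into A j))"
    by (simp add: sum_from_nat_into[OF fin(2), symmetric])
  also have "\<dots> = (rect_mat A B f * rect_mat B A g) $$ (i, j)"
    using ij by (simp add: rect_mat_def scalar_prod_def atLeast0LessThan)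
  finally show "kernel_mat A P $$ (i, j) = (rect_mat A B f * rect_mat B A g) $$ (i, j)" .
qed (auto simp: kernel_mat_def rect_mat_def)

lemma kernel_cmat_carrier [simp]: "kernel_cmat A P \<in> carrier_mat (card A) (card A)"
  by (simp add: kernel_cmat_def kernel_mat_def)

text \<open>\<open>f\<close> and \<open>g\<close> are the two half-steps: \<open>P\<close> moves
  from \<open>A\<close> through \<open>B\<close> back to \<open>A\<close>, and \<open>Q\<close>
  performs the same half-steps starting in \<open>B\<close>. The locale serves twice, for the
  Burnside kernel with its dual and for the dual kernel with its lumping.\<close>

locale kernel_factorization =
  fixes A :: "'a set" and B :: "'b set" and P :: "'a \<Rightarrow> 'a \<Rightarrow> real" and Q :: "'b \<Rightarrow> 'b \<Rightarrow> real"
    and f :: "'a \<Rightarrow> 'b \<Rightarrow> real" and g :: "'b \<Rightarrow> 'a \<Rightarrow> real"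
  assumes finite_A: "finite A" and finite_B: "finite B"
    and P_eq: "\<And>a a'. a \<in> A \<Longrightarrow> a' \<in> A \<Longrightarrow> P a a' = (\<Sum>b\<in>B. f a b * g b a')"
    and Q_eq: "\<And>b b'. b \<in> B \<Longrightarrow> b' \<in> B \<Longrightarrow> Q b b' = (\<Sum>a\<in>A. g b a * f a b')"
begin

lemma kernel_mat_P: "kernel_mat A P = rect_mat A B f * rect_mat B A g"
  using finite_A finite_B P_eq by (rule kernel_mat_factorization)

lemma kernel_mat_Q: "kernel_mat B Q = rect_mat B A g * rect_mat A B f"
  using finite_B finite_A Q_eq by (rule kernel_mat_factorization)

lemma kernel_cmat_P:
  "kernel_cmat A P = map_mat complex_of_real (rect_mat A B f) * map_mat complex_of_real (rect_mat B A g)"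
  unfolding kernel_cmat_def kernel_mat_P
  by (rule of_real_hom.mat_hom_mult[OF rect_mat_carrier rect_mat_carrier])

lemma kernel_cmat_Q:
  "kernel_cmat B Q = map_mat complex_of_real (rect_mat B A g) * map_mat complex_of_real (rect_mat A B f)"
  unfolding kernel_cmat_def kernel_mat_Q
  by (rule of_real_hom.mat_hom_mult[OF rect_mat_carrier rect_mat_carrier])

lemma alg_mult_eq:
  assumes "z \<noteq> 0"
  shows "alg_mult (kernel_cmat A P) z = alg_mult (kernel_cmat B Q) z"
  unfolding alg_mult_def kernel_cmat_P kernel_cmat_Q
  by (rule order_char_poly_mult_commute[where m = "card A" and n = "card B"]) (use assms in auto)

lemma spec_nz_eq: "spec_nz (kernel_cmat A P) = spec_nz (kernel_cmat B Q)"
  using alg_mult_eq unfolding spec_nz_def spectrum_def alg_mult_def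
  by (auto simp: eigenvalue_iff_order[OF kernel_cmat_carrier])

lemma det_eq:
  assumes "card B \<le> card A"
  shows "Determinant.det (z \<cdot>\<^sub>m 1\<^sub>m (card A) - kernel_cmat A P)
    = z ^ (card A - card B) * Determinant.det (z \<cdot>\<^sub>m 1\<^sub>m (card B) - kernel_cmat B Q)"
proof -
  have "monom 1 (card B) * char_poly (kernel_cmat A P) = monom 1 (card A) * char_poly (kernel_cmat B Q)"
    unfolding kernel_cmat_P kernel_cmat_Q
    by (rule char_poly_mult_commute) auto
  \<comment> \<open>The common monomial is cancelled between polynomials, before evaluation, so the
    determinant identity also covers \<open>z = 0\<close>.\<close>
  also have "monom 1 (card A) = monom 1 (card B) * monom (1 :: complex) (card A - card B)"
    using assms by (simp add: mult_monom)
  finally have "char_poly (kernel_cmat A P) = monom 1 (card A - card B) * char_poly (kernel_cmat B Q)"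
    by (simp add: mult.assoc)
  then have "poly (char_poly (kernel_cmat A P)) z
      = z ^ (card A - card B) * poly (char_poly (kernel_cmat B Q)) z"
    by (simp add: poly_monom)
  then show ?thesis
    by (simp add: poly_char_poly[OF kernel_cmat_carrier])
qed

lemma mat_rank_eq:
  assumes FG: "\<And>a b. a \<in> A \<Longrightarrow> b \<in> B \<Longrightarrow> \<alpha> a * f a b = \<beta> b * g b a"
    and pos: "\<And>a. a \<in> A \<Longrightarrow> \<alpha> a > 0" "\<And>b. b \<in> B \<Longrightarrow> \<beta> b > 0"
  shows "mat_rank (kernel_mat A P) = mat_rank (kernel_mat B Q)"
proof -
  have "vec_space.rank (card A) (rect_mat A B f * rect_mat B A g)
      = vec_space.rank (card B) (rect_mat B A g * rect_mat A B f)"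
    by (rule rank_mult_commute_weighted_transpose[where \<alpha> = "\<lambda>i. \<alpha> (from_nat_into A i)"
          and \<beta> = "\<lambda>j. \<beta> (from_nat_into B j)"])
       (auto simp: rect_mat_def FG pos from_nat_into_finite finite_A finite_B)
  then show ?thesis
    by (simp add: mat_rank_def kernel_mat_P kernel_mat_Q) (simp add: rect_mat_def)
qed

text \<open>The left factor of the matrix of \<open>P\<close> has only \<open>card B\<close>
  columns.\<close>

lemma mat_rank_le: "mat_rank (kernel_mat A P) \<le> card B"
proof -
  have "vec_space.rank (card A) (rect_mat A B f * rect_mat B A g) \<le> card B"
    using rank_mult_le[OF rect_mat_carrier rect_mat_carrier]
      vec_space.rank_le_nc[OF rect_mat_carrier] by (rule order_trans)
  then show ?thesis
    by (simp add: mat_rank_def kernel_mat_P) (simp add: rect_mat_def)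
qed

end

section \<open>Lumping of kernels that depend only on block labels\<close>

locale block_kernel =
  fixes A :: "'a set" and P :: "'a \<Rightarrow> 'a \<Rightarrow> real" and p :: "'a \<Rightarrow> 'b" and I :: "'b set"
    and F :: "'b \<Rightarrow> 'b \<Rightarrow> real"
  assumes finite_A: "finite A" and image_p: "p ` A = I"
    and P_eq: "\<And>s t. s \<in> A \<Longrightarrow> t \<in> A \<Longrightarrow> P s t = F (p s) (p t)"
begin

abbreviation block :: "'b \<Rightarrow> 'a set" where
  "block S \<equiv> {s \<in> A. p s = S}"

abbreviation L :: "'b \<Rightarrow> 'b \<Rightarrow> real" where
  "L \<equiv> \<lambda>S T. lumped P (block S) (block T)"

lemma finite_I: "finite I"
  using finite_A image_p by auto

lemma sum_blocks:
  fixes h :: "'a \<Rightarrow> real"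
  shows "(\<Sum>s\<in>A. h s) = (\<Sum>S\<in>I. \<Sum>s\<in>block S. h s)"
  using sum.group[OF finite_A finite_I, of p h] image_p by simp

text \<open>\<open>F S T\<close> is the probability of one single target in block \<open>T\<close>,
  so the lumped entry carries the block size as a factor. The choice made in \<open>lumped\<close>
  is harmless: block \<open>S\<close> is nonempty because \<open>p\<close> maps \<open>A\<close>
  onto \<open>I\<close>, and every member has the same row.\<close>

lemma L_eq:
  assumes "S \<in> I"
  shows "L S T = real (card (block T)) * F S T"
proof -
  have "\<exists>s. s \<in> block S" using assms image_p by auto
  then have "(SOME s. s \<in> block S) \<in> block S" by (rule someI_ex)
  then show ?thesis by (simp add: lumped_def P_eq)
qed

lemma sum_block_P:
  assumes "s \<in> A"
  shows "(\<Sum>t\<in>block T. P s t) = L (p s) T"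
proof -
  have "p s \<in> I" using assms image_p by auto
  then show ?thesis using assms by (simp add: P_eq L_eq)
qed

lemma factorization:
  "kernel_factorization A I P L (\<lambda>s S. of_bool (p s = S)) (\<lambda>S t. F S (p t))"
proof
  show "finite A" "finite I" by (fact finite_A finite_I)+
  fix s t assume "s \<in> A" "t \<in> A"
  then show "P s t = (\<Sum>S\<in>I. of_bool (p s = S) * F S (p t))"
    using image_p finite_I by (auto simp: P_eq of_bool_def if_distrib[of "\<lambda>x. x * _"] cong: if_cong)
next
  fix S T assume "S \<in> I" "T \<in> I"
  then show "L S T = (\<Sum>s\<in>A. F S (p s) * of_bool (p s = T))"
    using finite_A by (simp add: L_eq of_bool_def if_distrib[of "\<lambda>x. _ * x"] sum.If_cases Int_def
        cong: if_cong)
qed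

lemma strongly_lumpable: "strongly_lumpable A P ((\<lambda>S. block S) ` I)"
proof -
  have "partition_on A ((\<lambda>S. block S) ` I)"
    unfolding partition_on_def disjoint_def using image_p by auto
  moreover have "(\<Sum>t\<in>block T. P s t) = (\<Sum>t\<in>block T. P s' t)"
    if "s \<in> A" "s' \<in> A" "p s = p s'" for s s' T
    using that by (intro sum.cong) (auto simp: P_eq)
  ultimately show ?thesis unfolding strongly_lumpable_def by auto
qed

text \<open>The last step sees its target only through the block label. At time 0 the law is a point
  mass, whence \<open>t \<ge> 1\<close>. As \<open>kernel_pow\<close> peels off the first step, the
  induction keeps the starting state arbitrary.\<close>

lemma kernel_pow_block_const:
  assumes "t \<ge> 1" "s \<in> A" "u \<in> A" "u' \<in> A" "p u = p u'"
  shows "kernel_pow A P t s u = kernel_pow A P t s u'"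
  using assms(1,2)
proof (induction t arbitrary: s rule: dec_induct)
  case base
  have "kernel_pow A P (Suc 0) s w = P s w" if "w \<in> A" for w
    using that finite_A by (simp add: if_distrib[of "\<lambda>x. _ * x"] cong: if_cong)
  then show ?case using assms base by (simp add: P_eq)
next
  case (step t)
  then show ?case by simp
qed

text \<open>Induction on \<open>t\<close>: after exchanging the sums, the remaining factor depends
  on the intermediate state only through its block, so grouping by blocks turns the first step into
  a lumped step.\<close>

lemma kernel_pow_block_sum:
  assumes "s \<in> A"
  shows "(\<Sum>u\<in>block T. kernel_pow A P t s u) = kernel_pow I L t (p s) T"
  using assms
proof (induction t arbitrary: s)
  case 0
  then show ?case using finite_A by simp
next
  case (Suc t)
  have "(\<Sum>u\<in>block T. kernel_pow A P (Suc t) s u)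
      = (\<Sum>v\<in>A. P s v * (\<Sum>u\<in>block T. kernel_pow A P t v u))"
    by (simp add: sum_distrib_left) (rule sum.swap)
  also have "\<dots> = (\<Sum>v\<in>A. P s v * kernel_pow I L t (p v) T)"
    by (intro sum.cong refl) (simp add: Suc.IH)
  also have "\<dots> = (\<Sum>S\<in>I. \<Sum>v\<in>block S. P s v * kernel_pow I L t S T)"
    by (subst sum_blocks) (intro sum.cong refl, auto)
  also have "\<dots> = (\<Sum>S\<in>I. L (p s) S * kernel_pow I L t S T)"
    using Suc.prems by (intro sum.cong refl) (simp add: sum_block_P flip: sum_distrib_right)
  finally show ?case by simp
qed

text \<open>Both the law at time \<open>t\<close> and \<mu> are constant on each block. Their
  difference therefore keeps its sign there, and absolute values commute with the sum over a
  block.\<close>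

lemma mix_dist_eq:
  assumes t: "t \<ge> 1" and s: "s \<in> A"
    and \<mu>: "\<And>u u'. u \<in> A \<Longrightarrow> u' \<in> A \<Longrightarrow> p u = p u' \<Longrightarrow> \<mu> u = \<mu> u'"
  shows "mix_dist A P \<mu> s t = mix_dist I L (\<lambda>S. \<Sum>u\<in>block S. \<mu> u) (p s) t"
proof -
  let ?d = "\<lambda>u. kernel_pow A P t s u - \<mu> u"
  have "(\<Sum>u\<in>A. \<bar>?d u\<bar>) = (\<Sum>S\<in>I. \<bar>\<Sum>u\<in>block S. ?d u\<bar>)"
  proof (subst sum_blocks, intro sum.cong refl)
    fix S assume "S \<in> I"
    then obtain w where w: "w \<in> A" "p w = S" using image_p by auto
    have "?d u = ?d w" if "u \<in> A" "p u = S" for u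
      using that w kernel_pow_block_const[OF t s, of u w] \<mu>[of u w] by simp
    then show "(\<Sum>u\<in>block S. \<bar>?d u\<bar>) = \<bar>\<Sum>u\<in>block S. ?d u\<bar>"
      by (simp add: abs_mult)
  qed
  also have "\<dots> = (\<Sum>S\<in>I. \<bar>kernel_pow I L t (p s) S - (\<Sum>u\<in>block S. \<mu> u)\<bar>)"
    by (intro sum.cong refl) (simp add: sum_subtractf kernel_pow_block_sum[OF s])
  finally show ?thesis by (simp add: mix_dist_def tv_dist_def)
qed

end

text \<open>Doeblin minorization by the common column \<open>a\<close> makes the kernel a strict contraction on
  differences of laws.\<close>

lemma stationary_law_unique:
  fixes L :: "'a \<Rightarrow> 'a \<Rightarrow> real"
  assumes fin: "finite I" and nonneg: "\<And>s t. s \<in> I \<Longrightarrow> t \<in> I \<Longrightarrow> 0 \<le> L s t"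
    and stoch: "\<And>s. s \<in> I \<Longrightarrow> (\<Sum>t\<in>I. L s t) = 1"
    and a: "a \<in> I" "\<And>s. s \<in> I \<Longrightarrow> L s a > 0"
    and \<mu>: "stationary_law I L \<mu>" and \<nu>: "stationary_law I L \<nu>" and s: "s \<in> I"
  shows "\<mu> s = \<nu> s"
proof -
  define \<epsilon> where "\<epsilon> = Min ((\<lambda>s. L s a) ` I)"
  have \<epsilon>: "\<epsilon> > 0"
    unfolding \<epsilon>_def using fin a by (subst Min_gr_iff) auto
  have \<epsilon>_le: "\<epsilon> \<le> L s a" if "s \<in> I" for s
    using that fin by (auto simp: \<epsilon>_def)
  \<comment> \<open>Removing mass \<epsilon> from column \<open>a\<close> leaves a nonnegative
    kernel with all row sums 1 - \<epsilon>.\<close>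
  define R where "R s t = L s t - (if t = a then \<epsilon> else 0)" for s t
  have R: "0 \<le> R s t" if "s \<in> I" "t \<in> I" for s t
    using that \<epsilon>_le nonneg by (auto simp: R_def)
  have R_sum: "(\<Sum>t\<in>I. R s t) = 1 - \<epsilon>" if "s \<in> I" for s
    using that fin a by (simp add: R_def sum_subtractf stoch)
  define d where "d s = \<mu> s - \<nu> s" for s
  have d0: "(\<Sum>s\<in>I. d s) = 0"
    using \<mu> \<nu> by (simp add: d_def sum_subtractf stationary_law_def)
  have d: "d t = (\<Sum>s\<in>I. d s * R s t)" if "t \<in> I" for t
  proof -
    have "d t = (\<Sum>s\<in>I. d s * L s t)"
      using \<mu> \<nu> that by (simp add: d_def left_diff_distrib sum_subtractf stationary_law_def)
    \<comment> \<open>The removed column acts on \<open>d\<close> only through its total mass, which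
      is zero. So \<open>d\<close> is invariant under \<open>R\<close>, which shrinks the l1 norm by
      the factor 1 - \<epsilon>; this forces \<open>d\<close> to vanish on \<open>I\<close>.\<close>
    also have "\<dots> = (\<Sum>s\<in>I. d s * R s t) + (\<Sum>s\<in>I. d s) * (if t = a then \<epsilon> else 0)"
      by (simp add: R_def right_diff_distrib sum_subtractf sum_distrib_right)
    finally show ?thesis by (simp add: d0)
  qed
  have "(\<Sum>t\<in>I. \<bar>d t\<bar>) \<le> (\<Sum>t\<in>I. \<Sum>s\<in>I. \<bar>d s\<bar> * R s t)"
  proof (rule sum_mono)
    fix t assume t: "t \<in> I"
    have "\<bar>d t\<bar> \<le> (\<Sum>s\<in>I. \<bar>d s * R s t\<bar>)"
      by (subst d[OF t]) (rule sum_abs)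
    also have "\<dots> = (\<Sum>s\<in>I. \<bar>d s\<bar> * R s t)"
      using t by (intro sum.cong refl) (simp add: abs_mult R)
    finally show "\<bar>d t\<bar> \<le> \<dots>" .
  qed
  also have "\<dots> = (\<Sum>s\<in>I. \<bar>d s\<bar> * (\<Sum>t\<in>I. R s t))"
    by (subst sum.swap) (simp add: sum_distrib_left)
  also have "\<dots> = (1 - \<epsilon>) * (\<Sum>s\<in>I. \<bar>d s\<bar>)"
    by (simp add: R_sum sum_distrib_left mult.commute)
  finally have "\<epsilon> * (\<Sum>s\<in>I. \<bar>d s\<bar>) \<le> 0" by (simp add: algebra_simps)
  then have "(\<Sum>s\<in>I. \<bar>d s\<bar>) \<le> 0" using \<epsilon> by (simp add: mult_le_0_iff)
  then have "(\<Sum>s\<in>I. \<bar>d s\<bar>) = 0" by (intro antisym sum_nonneg) auto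
  then show ?thesis using s fin by (simp add: sum_nonneg_eq_0_iff d_def)
qed

section \<open>Words, Stirling numbers and derangements\<close>

text \<open>Split off the first letter \<open>a\<close>: the tail has symbol set \<open>A\<close> or
  \<open>A - {a}\<close>, according to whether \<open>a\<close> occurs again. With card A choices of
  \<open>a\<close> this is the Stirling recurrence multiplied by the factorial.\<close>

lemma card_words_with_set:
  fixes A :: "'a set"
  assumes "finite A"
  shows "card {x. length x = n \<and> set x = A} = Stirling n (card A) * fact (card A)"
  using assms
proof (induction n arbitrary: A)
  case 0
  then show ?case
  proof (cases "A = {}")
    case True
    then have "{x :: 'a list. length x = 0 \<and> set x = A} = {[]}" by auto
    then show ?thesis using True by simp
  next
    case False
    then have "{x :: 'a list. length x = 0 \<and> set x = A} = {}" by auto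
    moreover obtain m where "card A = Suc m" using False 0 by (cases "card A") auto
    ultimately show ?thesis by simp
  qed
next
  case (Suc n)
  let ?W = "\<lambda>B. {x. length x = n \<and> set x = B}"
  have finW: "finite (?W B)" if "finite B" for B :: "'a set"
    by (rule finite_subset[OF _ finite_lists_length_eq[OF that, of n]]) auto
  have "{x. length x = Suc n \<and> set x = A} = (\<Union>a\<in>A. (#) a ` (?W A \<union> ?W (A - {a})))"
  proof (intro equalityI subsetI)
    fix x assume "x \<in> {x. length x = Suc n \<and> set x = A}"
    then obtain a y where x: "x = a # y" "length y = n" "A = insert a (set y)"
      by (cases x) auto
    have "set y = A \<or> set y = A - {a}"
      unfolding x by blast
    then have "y \<in> ?W A \<union> ?W (A - {a})" "a \<in> A"
      using x by auto
    then show "x \<in> (\<Union>a\<in>A. (#) a ` (?W A \<union> ?W (A - {a})))"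
      unfolding x(1) by blast
  next
    fix x assume "x \<in> (\<Union>a\<in>A. (#) a ` (?W A \<union> ?W (A - {a})))"
    then obtain a y where x: "x = a # y" "a \<in> A" "length y = n" "set y = A \<or> set y = A - {a}"
      by blast
    then have "set x = A" by (elim disjE) (simp_all add: insert_absorb)
    then show "x \<in> {x. length x = Suc n \<and> set x = A}" by (simp add: x)
  qed
  also have "card \<dots> = (\<Sum>a\<in>A. card ((#) a ` (?W A \<union> ?W (A - {a}))))"
    using Suc.prems finW by (intro card_UN_disjoint) auto
  also have "\<dots> = (\<Sum>a\<in>A. card (?W A) + card (?W (A - {a})))"
    using Suc.prems finW by (intro sum.cong refl) (subst card_image, auto intro!: card_Un_disjoint)
  also have "\<dots> = (\<Sum>a\<in>A. Stirling n (card A) * fact (card A)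
      + Stirling n (card A - 1) * fact (card A - 1))"
    using Suc.prems by (intro sum.cong refl) (simp add: Suc.IH)
  also have "\<dots> = Stirling (Suc n) (card A) * fact (card A)"
    \<comment> \<open>For empty \<open>A\<close> both sides are 0; otherwise the recurrence applies
      with \<open>card A - 1\<close> an honest predecessor.\<close>
    by (cases "card A") (simp_all add: algebra_simps)
  finally show ?case .
qed

text \<open>Words are grouped by symbol set, then symbol sets by size. The lumped entries, the
  expectation over random words and the normalizing constant are all instances.\<close>

lemma sum_over_words:
  fixes h :: "nat \<Rightarrow> real"
  assumes J: "finite J"
  shows "(\<Sum>x\<in>{x. set x \<subseteq> J \<and> length x = n}. h (card (set x)))
    = (\<Sum>m\<le>card J. real (card J choose m) * real (Stirling n m) * fact m * h m)"
proof -
  have fin: "finite {x. set x \<subseteq> J \<and> length x = n}"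
    using J by (rule finite_lists_length_eq)
  have "(\<Sum>x\<in>{x. set x \<subseteq> J \<and> length x = n}. h (card (set x)))
      = (\<Sum>A\<in>Pow J. \<Sum>x\<in>{x \<in> {x. set x \<subseteq> J \<and> length x = n}. set x = A}. h (card (set x)))"
    using fin J by (intro sum.group[symmetric]) auto
  also have "\<dots> = (\<Sum>A\<in>Pow J. real (Stirling n (card A)) * fact (card A) * h (card A))"
  proof (intro sum.cong refl)
    fix A assume "A \<in> Pow J"
    then have "{x \<in> {x. set x \<subseteq> J \<and> length x = n}. set x = A} = {x. length x = n \<and> set x = A}"
      and "finite A" using J finite_subset by auto
    then show "(\<Sum>x\<in>{x \<in> {x. set x \<subseteq> J \<and> length x = n}. set x = A}. h (card (set x)))
        = real (Stirling n (card A)) * fact (card A) * h (card A)"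
      by (simp add: card_words_with_set)
  qed
  also have "\<dots> = (\<Sum>m\<le>card J. \<Sum>A\<in>{A \<in> Pow J. card A = m}. real (Stirling n (card A)) * fact (card A) * h (card A))"
    using J by (intro sum.group[symmetric]) (auto intro: card_mono)
  also have "\<dots> = (\<Sum>m\<le>card J. real (card J choose m) * real (Stirling n m) * fact m * h m)"
    by (intro sum.cong refl) (simp add: n_subsets[OF J])
  finally show ?thesis .
qed

text \<open>S(n,0) = 0 for n >= 1, and S(n,m) = 0 for m > n.\<close>

lemma sum_choose_Stirling_restrict:
  fixes h :: "nat \<Rightarrow> real"
  assumes "n \<ge> 1"
  shows "(\<Sum>m\<le>j. real (j choose m) * real (Stirling n m) * h m)
    = (\<Sum>m=1..min j n. real (j choose m) * real (Stirling n m) * h m)"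
proof (rule sum.mono_neutral_right)
  obtain n' where "n = Suc n'" using assms by (cases n) auto
  then show "\<forall>i\<in>{..j} - {1..min j n}. real (j choose i) * real (Stirling n i) * h i = 0"
    by (auto simp: not_le Suc_le_eq)
qed auto

text \<open>The exponential generating function of the Stirling numbers. For E = e^u - 1 one has E'
  = E + 1, so the derivative of E^(l+1) is (l+1)(E^(l+1) + E^l); comparing coefficients gives the
  Stirling recurrence.\<close>

lemma fps_nth_exp_minus_one_power:
  "fps_nth ((fps_exp 1 - 1) ^ m :: real fps) n = real (Stirling n m) * fact m / fact n"
proof (induction n arbitrary: m)
  case 0
  show ?case by (cases m) auto
next
  case (Suc n)
  let ?E = "fps_exp 1 - 1 :: real fps"
  show ?case
  proof (cases m)
    case 0
    then show ?thesis by simp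
  next
    case (Suc l)
    have "fps_deriv (?E ^ Suc l) = of_nat (Suc l) * ?E ^ Suc l + of_nat (Suc l) * ?E ^ l"
    proof -
      have "fps_deriv (?E ^ Suc l) = of_nat (Suc l) * fps_exp 1 * ?E ^ l"
        by (subst fps_deriv_power') simp
      also have "\<dots> = of_nat (Suc l) * (?E + 1) * ?E ^ l" by simp
      finally show ?thesis by (simp only: distrib_left distrib_right mult_1_right power_Suc mult.assoc)
    qed
    then have "fps_nth (fps_deriv (?E ^ Suc l)) n
        = real (Suc l) * fps_nth (?E ^ Suc l) n + real (Suc l) * fps_nth (?E ^ l) n"
      by (simp only: fps_add_nth fps_mult_of_nat_nth)
    moreover define e where "e = fps_nth (?E ^ Suc l) (Suc n)"
    ultimately have "real (Suc n) * e = real (Suc l) * (real (Stirling n (Suc l)) * fact (Suc l) / fact n)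
        + real (Suc l) * (real (Stirling n l) * fact l / fact n)"
      by (simp only: fps_deriv_nth Suc.IH Suc_eq_plus1)
    then have "e = (real (Suc l) * (real (Stirling n (Suc l)) * fact (Suc l) / fact n)
        + real (Suc l) * (real (Stirling n l) * fact l / fact n)) / real (Suc n)"
      by (simp add: eq_divide_eq mult.commute del: of_nat_Suc fact_Suc)
    also have "\<dots> = real (Stirling (Suc n) (Suc l)) * fact (Suc l) / fact (Suc n)"
    proof -
      \<comment> \<open>The factorials and Stirling numbers are replaced by variables, with
        \<open>g\<close> for l!, \<open>f\<close> for n! and \<open>N\<close> for n + 1, so that the
        recurrence becomes a plain field identity.\<close>
      have "(L * (a * (L * g) / f) + L * (b * g / f)) / N = (L * a + b) * (L * g) / (N * f)"
        if "f \<noteq> 0" "N \<noteq> 0" for L N a b f g :: real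
        using that by (simp add: field_simps)
      from this[of "fact n" "real (Suc n)" "real (Suc l)"] show ?thesis
        by (simp only: fact_Suc Stirling.simps of_nat_add of_nat_mult) simp
    qed
    finally show ?thesis by (simp only: \<open>m = Suc l\<close> e_def)
  qed
qed

text \<open>Binomial expansion in powers of z(e^u - 1), with [z^k] e^z z^m = 1/(k-m)!. The
  assumption \<open>j \<le> k\<close> keeps every \<open>m\<close> in range, so the subtraction
  \<open>k - m\<close> is never truncated.\<close>

lemma fs_gf_nth:
  assumes "j \<le> k"
  shows "fps_nth (fps_nth (fs_gf j) k) n
    = (\<Sum>m\<le>j. real (j choose m) * real (Stirling n m) * (fact m / (fact n * fact (k - m))))"
proof -
  let ?E = "fps_exp 1 - 1 :: real fps"
  have E: "exp_u - 1 = fps_const ?E"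
    by (simp add: exp_u_def flip: fps_const_sub fps_const_1_eq_1)
  have "(1 + fps_X * (exp_u - 1)) ^ j = (\<Sum>m\<le>j. of_nat (j choose m) * (fps_X * fps_const ?E) ^ m)"
    by (subst add.commute) (simp add: binomial_ring E)
  also have "\<dots> = (\<Sum>m\<le>j. fps_const (of_nat (j choose m) * ?E ^ m) * fps_X ^ m)"
    by (intro sum.cong refl)
       (simp add: power_mult_distrib fps_of_nat mult_ac flip: fps_const_mult)
  finally have "fs_gf j = (\<Sum>m\<le>j. fps_const (of_nat (j choose m) * ?E ^ m) * (exp_z * fps_X ^ m))"
    by (simp add: fs_gf_def sum_distrib_left mult_ac)
  then have "fps_nth (fs_gf j) k = (\<Sum>m\<le>j. of_nat (j choose m) * ?E ^ m * fps_const (1 / fact (k - m)))"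
    using assms by (simp add: fps_sum_nth exp_z_def fps_X_power_mult_right_nth)
  then show ?thesis
    by (simp add: fps_sum_nth fps_nth_exp_minus_one_power field_simps)
qed

section \<open>Derangements\<close>

lemma card_derangements:
  assumes "finite D"
  shows "card {p. p permutes D \<and> (\<forall>i\<in>D. p i \<noteq> i)} = derangements (card D)"
proof -
  obtain f where "bij_betw f D {1..card D}"
    using assms ex_bij_betw_finite_nat[OF assms] bij_betw_iff_card[of D "{1..card D}"] by auto
  from bij_betw_same_card[OF bij_betw_derangements[OF this]] show ?thesis
    by (simp add: derangements_def)
qed

lemma derangements_pos:
  assumes "m \<noteq> 1"
  shows "derangements m > 0"
proof -
  \<comment> \<open>The cyclic shift of 1, ..., m. It has a fixed point in this range only for m =
    1; for m = 0 it is the identity and the condition is empty.\<close>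
  define p where "p i = (if i \<in> {1..m} then if i = m then 1 else Suc i else i)" for i :: nat
  have "inj_on p {1..m}" by (auto simp: inj_on_def p_def split: if_splits)
  moreover have "p ` {1..m} \<subseteq> {1..m}" by (auto simp: p_def)
  ultimately have "bij_betw p {1..m} {1..m}"
    by (simp add: bij_betw_def endo_inj_surj)
  then have "p permutes {1..m}"
    by (rule bij_imp_permutes) (auto simp: p_def)
  moreover have "\<forall>i\<in>{1..m}. p i \<noteq> i"
    using assms by (auto simp: p_def)
  ultimately have "p \<in> {p. p permutes {1..m} \<and> (\<forall>i\<in>{1..m}. p i \<noteq> i)}" by simp
  moreover have "finite {p. p permutes {1..m} \<and> (\<forall>i\<in>{1..m}. p i \<noteq> i)}"
    by (rule finite_subset[OF _ finite_permutations[of "{1..m}"]]) auto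
  ultimately show ?thesis unfolding derangements_def by (auto simp: card_gt_0_iff)
qed

section \<open>Fixed words, stabilizers and fixed-symbol blocks\<close>

lemma finite_sym_grp: "finite (sym_grp k)"
  unfolding sym_grp_def by (rule finite_permutations) simp

lemma finite_sym_grp_star: "finite (sym_grp_star k)"
  unfolding sym_grp_star_def using finite_sym_grp by simp

lemma finite_words: "finite (words k n)"
  using finite_lists_length_eq[of "{1..k}" n] by (simp add: words_def conj_commute)

lemma fixed_words_eq:
  "fixed_words k n g = {x. set x \<subseteq> fix_set k g \<and> length x = n}"
proof -
  have "map g x = x \<longleftrightarrow> (\<forall>a\<in>set x. g a = a)" for x
    using map_eq_conv[of g x id] by simp
  then show ?thesis unfolding fixed_words_def words_def fix_set_def by auto
qed

lemma finite_fix_set: "finite (fix_set k g)"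
  by (simp add: fix_set_def)

lemma card_fixed_words: "card (fixed_words k n g) = card (fix_set k g) ^ n"
  unfolding fixed_words_eq by (rule card_lists_length_eq[OF finite_fix_set])

lemma card_stabilizer:
  assumes "x \<in> words k n"
  shows "card (stabilizer k x) = fact (k - card (set x))"
proof -
  have sub: "set x \<subseteq> {1..k}" using assms by (simp add: words_def)
  have fixes_iff: "map g x = x \<longleftrightarrow> (\<forall>a\<in>set x. g a = a)" for g
    using map_eq_conv[of g x id] by simp
  \<comment> \<open>Fixing a word means fixing each of its symbols, so the stabilizer is the
    symmetric group on the symbols that do not occur.\<close>
  have "stabilizer k x = {g. g permutes ({1..k} - set x)}"
  proof (intro equalityI subsetI)
    fix g assume "g \<in> stabilizer k x"
    then have g: "g permutes {1..k}" "\<forall>a\<in>set x. g a = a"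
      by (auto simp: stabilizer_def sym_grp_def fixes_iff)
    have "g permutes ({1..k} - set x)"
      by (rule permutes_superset[OF g(1)]) (use g(2) in auto)
    then show "g \<in> {g. g permutes ({1..k} - set x)}" by simp
  next
    fix g assume "g \<in> {g. g permutes ({1..k} - set x)}"
    then have g: "g permutes ({1..k} - set x)" by simp
    then have "g permutes {1..k}" by (rule permutes_subset) auto
    then show "g \<in> stabilizer k x"
      using permutes_not_in[OF g] by (auto simp: stabilizer_def sym_grp_def fixes_iff)
  qed
  then show ?thesis
    using sub by (simp add: card_permutations card_Diff_subset)
qed

lemma fs_indexD:
  assumes "S \<in> fs_index k"
  shows "card S \<le> k" "finite S" "S \<subseteq> {1..k}" "card S > 0"
proof -
  show S: "S \<subseteq> {1..k}" using assms by (simp add: fs_index_def)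
  show fin: "finite S" by (rule finite_subset[OF S]) simp
  have "S \<noteq> {}" using assms by (simp add: fs_index_def)
  with fin show "card S > 0" by (simp add: card_gt_0_iff)
  show "card S \<le> k" using card_mono[OF _ S] by simp
qed

lemma fs_block_eq:
  assumes "S \<in> fs_index k"
  shows "fs_block k S = {p. p permutes ({1..k} - S) \<and> (\<forall>i\<in>{1..k} - S. p i \<noteq> i)}"
proof (intro equalityI subsetI)
  fix g assume "g \<in> fs_block k S"
  then have g: "g permutes {1..k}" and S: "S = fix_set k g"
    by (auto simp: fs_block_def sym_grp_star_def sym_grp_def)
  have "g permutes ({1..k} - S)"
    by (rule permutes_superset[OF g]) (auto simp: S fix_set_def)
  then show "g \<in> {p. p permutes ({1..k} - S) \<and> (\<forall>i\<in>{1..k} - S. p i \<noteq> i)}"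
    by (auto simp: S fix_set_def)
next
  fix g assume "g \<in> {p. p permutes ({1..k} - S) \<and> (\<forall>i\<in>{1..k} - S. p i \<noteq> i)}"
  then have g: "g permutes ({1..k} - S)" and d: "\<forall>i\<in>{1..k} - S. g i \<noteq> i" by auto
  have "g permutes {1..k}" by (rule permutes_subset[OF g]) auto
  moreover have "fix_set k g = S"
  proof (intro equalityI subsetI)
    fix i assume "i \<in> fix_set k g"
    then show "i \<in> S" using d by (auto simp: fix_set_def)
  next
    fix i assume "i \<in> S"
    then show "i \<in> fix_set k g"
      using permutes_not_in[OF g, of i] fs_indexD(3)[OF assms] by (auto simp: fix_set_def)
  qed
  ultimately show "g \<in> fs_block k S"
    using assms by (auto simp: fs_block_def sym_grp_star_def sym_grp_def fs_index_def)
qed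

lemma card_fs_block:
  assumes "S \<in> fs_index k"
  shows "card (fs_block k S) = derangements (k - card S)"
  using card_derangements[of "{1..k} - S"] fs_indexD[OF assms]
  by (simp add: fs_block_eq[OF assms] card_Diff_subset)

text \<open>No permutation moves exactly one symbol, which excludes size k - 1. Conversely, a
  complement whose size is not 1 carries a derangement, so the block of \<open>S\<close> is
  inhabited.\<close>

lemma fix_set_image: "fix_set k ` sym_grp_star k = fs_index k"
proof (intro equalityI subsetI)
  fix S assume "S \<in> fix_set k ` sym_grp_star k"
  then obtain g where g: "g permutes {1..k}" "S = fix_set k g" "S \<noteq> {}"
    by (auto simp: sym_grp_star_def sym_grp_def)
  have S: "S \<subseteq> {1..k}" using g by (auto simp: fix_set_def)
  have "card S \<noteq> k - 1"
  proof
    assume "card S = k - 1"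
    moreover have "k \<ge> 1" using g S by (cases k) auto
    ultimately have "card ({1..k} - S) = 1"
      using S finite_subset[OF S] by (simp add: card_Diff_subset)
    then obtain a where a: "{1..k} - S = {a}" by (rule card_1_singletonE)
    have "g x = x" if "x \<in> {1..k} - {a}" for x
    proof -
      have "x \<in> S" using that a by blast
      then show ?thesis by (simp add: g(2) fix_set_def)
    qed
    then have "g permutes {a}" by (rule permutes_superset[OF g(1)])
    then have "g a = a" by simp
    moreover have "a \<in> {1..k}" "a \<notin> S" using a by auto
    ultimately show False by (simp add: g(2) fix_set_def)
  qed
  then show "S \<in> fs_index k" using S g by (auto simp: fs_index_def)
next
  fix S assume S: "S \<in> fs_index k"
  then have "k - card S \<noteq> 1"
    using fs_indexD[OF S] by (auto simp: fs_index_def)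
  then have "card (fs_block k S) > 0"
    by (simp add: card_fs_block[OF S] derangements_pos)
  then obtain g where "g \<in> fs_block k S" by (auto simp: card_gt_0_iff)
  then show "S \<in> fix_set k ` sym_grp_star k" by (auto simp: fs_block_def)
qed

lemma card_fs_index:
  assumes "k \<ge> 2"
  shows "card (fs_index k) = 2 ^ k - k - 1"
proof -
  let ?B = "{S. S \<subseteq> {1..k} \<and> card S = k - 1}"
  have "fs_index k = Pow {1..k} - ({{}} \<union> ?B)"
    using assms by (auto simp: fs_index_def)
  then have "card (fs_index k) = card (Pow {1..k}) - card ({{}} \<union> ?B)"
    by (simp only:) (rule card_Diff_subset, auto)
  \<comment> \<open>For k >= 2 the empty set does not have size k - 1, so the two excluded families
    are disjoint.\<close>
  moreover have "card ({{}} \<union> ?B) = 1 + k"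
    using assms n_subsets[of "{1..k}" "k - 1"] binomial_symmetric[of 1 k]
    by (subst card_Un_disjoint) auto
  ultimately show ?thesis
    by (simp add: card_Pow)
qed

section \<open>The dual kernel on fixed-symbol sets\<close>

text \<open>The value Q(g,h) for any single g with fixed set \<open>S\<close> and h with fixed set
  \<open>T\<close>: the words fixed by both are those over the common symbols, and the stabilizer of
  x has order (k - |set x|)!.\<close>

definition fs_density :: "nat \<Rightarrow> nat \<Rightarrow> nat set \<Rightarrow> nat set \<Rightarrow> real" where
  "fs_density k n S T = 1 / real (card S) ^ n *
     (\<Sum>x\<in>{x. set x \<subseteq> S \<inter> T \<and> length x = n}. 1 / fact (k - card (set x)))"

lemma dual_kernel_eq:
  "dual_kernel k n g h = fs_density k n (fix_set k g) (fix_set k h)"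
proof -
  have eq: "fixed_words k n g \<inter> fixed_words k n h
      = {x. set x \<subseteq> fix_set k g \<inter> fix_set k h \<and> length x = n}"
    by (auto simp: fixed_words_eq)
  have "1 / real (card (stabilizer k x)) = 1 / fact (k - card (set x))"
    if "x \<in> fixed_words k n g \<inter> fixed_words k n h" for x
    using card_stabilizer[of x k n] that by (simp add: fixed_words_def)
  then have "(\<Sum>x\<in>fixed_words k n g \<inter> fixed_words k n h. 1 / real (card (stabilizer k x)))
      = (\<Sum>x\<in>fixed_words k n g \<inter> fixed_words k n h. 1 / fact (k - card (set x)))"
    by (intro sum.cong refl)
  then show ?thesis
    unfolding dual_kernel_def fs_density_def by (simp only: eq card_fixed_words of_nat_power)
qed

lemma fs_density_eq_Stirling_sum:
  assumes "finite (S \<inter> T)"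
  shows "fs_density k n S T = 1 / real (card S) ^ n *
     (\<Sum>m\<le>card (S \<inter> T). real (card (S \<inter> T) choose m) * real (Stirling n m) * (fact m / fact (k - m)))"
  unfolding fs_density_def using sum_over_words[OF assms, of "\<lambda>m. 1 / fact (k - m)" n]
  by (simp add: mult.assoc)

lemma expectation_words:
  assumes "j \<ge> 1"
  shows "measure_pmf.expectation (pmf_of_set (words j n)) (\<lambda>w. 1 / fact (k - card (set w)))
    = (\<Sum>m\<le>j. real (j choose m) * real (Stirling n m) * (fact m / fact (k - m))) / real j ^ n"
proof -
  have words: "words j n = {x. set x \<subseteq> {1..j} \<and> length x = n}"
    by (auto simp: words_def)
  have card: "card (words j n) = j ^ n"
    unfolding words by (subst card_lists_length_eq) auto
  \<comment> \<open>\<open>pmf_of_set\<close> is the uniform law only on a nonempty finite set; this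
    is where \<open>j \<ge> 1\<close> enters.\<close>
  then have "words j n \<noteq> {}" using assms by auto
  then have "measure_pmf.expectation (pmf_of_set (words j n)) (\<lambda>w. 1 / fact (k - card (set w)))
      = (\<Sum>x\<in>words j n. 1 / fact (k - card (set x))) / real (card (words j n))"
    by (intro integral_pmf_of_set finite_words)
  then show ?thesis
    unfolding card using sum_over_words[of "{1..j}" "\<lambda>m. 1 / fact (k - m)" n]
    by (simp add: words mult.assoc)
qed

section \<open>Factorizations, row sums and the stationary law\<close>

lemma block_kernel_dual:
  "block_kernel (sym_grp_star k) (dual_kernel k n) (fix_set k) (fs_index k) (fs_density k n)"
  by standard (simp_all add: finite_sym_grp_star fix_set_image dual_kernel_eq)

text \<open>A nonempty word has a first letter, fixed by everything in its stabilizer; hence the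
  stabilizer lies in \<open>sym_grp_star k\<close>. For n = 0 derangements would stabilize the empty
  word.\<close>

lemma stabilizer_eq:
  assumes "n \<ge> 1" "x \<in> words k n"
  shows "stabilizer k x = {g \<in> sym_grp_star k. x \<in> fixed_words k n g}"
proof -
  have "hd x \<in> set x" using assms by (cases x) (auto simp: words_def)
  then have "fix_set k g \<noteq> {}" if "x \<in> fixed_words k n g" for g
    using that by (auto simp: fixed_words_eq)
  then show ?thesis
    using assms(2) by (auto simp: stabilizer_def sym_grp_star_def fixed_words_def)
qed

text \<open>The half-steps pick a uniform element of the stabilizer of a word and a uniform word
  fixed by a permutation. Indicators extend the sums over intersections to the full state
  spaces.\<close>

lemma kernel_factorization_burnside:
  assumes "n \<ge> 1"
  shows "kernel_factorization (words k n) (sym_grp_star k) (burnside_kernel k n) (dual_kernel k n)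
    (\<lambda>x g. of_bool (x \<in> fixed_words k n g) / real (card (stabilizer k x)))
    (\<lambda>g x. of_bool (x \<in> fixed_words k n g) / real (card (fixed_words k n g)))"
proof
  show "finite (words k n)" "finite (sym_grp_star k)"
    by (rule finite_words finite_sym_grp_star)+
  fix x y assume xy: "x \<in> words k n" "y \<in> words k n"
  have "stabilizer k x \<inter> stabilizer k y
      = {g \<in> sym_grp_star k. x \<in> fixed_words k n g \<and> y \<in> fixed_words k n g}"
    using assms xy by (auto simp: stabilizer_eq)
  then show "burnside_kernel k n x y = (\<Sum>g\<in>sym_grp_star k.
      of_bool (x \<in> fixed_words k n g) / real (card (stabilizer k x)) *
      (of_bool (y \<in> fixed_words k n g) / real (card (fixed_words k n g))))"
    unfolding burnside_kernel_def using finite_sym_grp_star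
    by (simp only: sum.inter_filter sum_distrib_left) (auto intro!: sum.cong)
next
  fix g h assume "g \<in> sym_grp_star k" "h \<in> sym_grp_star k"
  have "fixed_words k n g \<inter> fixed_words k n h
      = {x \<in> words k n. x \<in> fixed_words k n g \<and> x \<in> fixed_words k n h}"
    by (auto simp: fixed_words_def)
  then show "dual_kernel k n g h = (\<Sum>x\<in>words k n.
      of_bool (x \<in> fixed_words k n g) / real (card (fixed_words k n g)) *
      (of_bool (x \<in> fixed_words k n h) / real (card (stabilizer k x))))"
    unfolding dual_kernel_def using finite_words
    by (simp only: sum.inter_filter sum_distrib_left) (auto intro!: sum.cong)
qed

lemma card_fixed_words_pos:
  assumes "g \<in> sym_grp_star k"
  shows "card (fixed_words k n g) > 0"
  using assms by (simp add: sym_grp_star_def card_fixed_words card_gt_0_iff finite_fix_set)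

lemma card_stabilizer_pos:
  assumes "x \<in> words k n"
  shows "card (stabilizer k x) > 0"
  by (simp add: card_stabilizer[OF assms])

text \<open>Both half-steps are stochastic: summing first over \<open>h\<close>, then over
  \<open>x\<close>, gives 1 each time.\<close>

lemma dual_kernel_row_sum:
  assumes "n \<ge> 1" "g \<in> sym_grp_star k"
  shows "(\<Sum>h\<in>sym_grp_star k. dual_kernel k n g h) = 1"
proof -
  interpret kernel_factorization "words k n" "sym_grp_star k" "burnside_kernel k n" "dual_kernel k n"
    "\<lambda>x g. of_bool (x \<in> fixed_words k n g) / real (card (stabilizer k x))"
    "\<lambda>g x. of_bool (x \<in> fixed_words k n g) / real (card (fixed_words k n g))"
    by (rule kernel_factorization_burnside[OF assms(1)])
  have stab: "(\<Sum>h\<in>sym_grp_star k. of_bool (x \<in> fixed_words k n h) / real (card (stabilizer k x))) = 1"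
    if "x \<in> words k n" for x
  proof -
    have "(\<Sum>h\<in>sym_grp_star k. of_bool (x \<in> fixed_words k n h) / real (card (stabilizer k x)))
        = (\<Sum>h\<in>stabilizer k x. 1 / real (card (stabilizer k x)))"
      unfolding stabilizer_eq[OF assms(1) that] sum.inter_filter[OF finite_sym_grp_star]
      by (intro sum.cong) auto
    then show ?thesis using card_stabilizer_pos[OF that] by simp
  qed
  have "(\<Sum>h\<in>sym_grp_star k. dual_kernel k n g h) = (\<Sum>h\<in>sym_grp_star k. \<Sum>x\<in>words k n.
      of_bool (x \<in> fixed_words k n g) / real (card (fixed_words k n g)) *
      (of_bool (x \<in> fixed_words k n h) / real (card (stabilizer k x))))"
    using assms(2) by (simp add: Q_eq)
  also have "\<dots> = (\<Sum>x\<in>words k n. of_bool (x \<in> fixed_words k n g) / real (card (fixed_words k n g)) *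
      (\<Sum>h\<in>sym_grp_star k. of_bool (x \<in> fixed_words k n h) / real (card (stabilizer k x))))"
    by (subst sum.swap) (simp only: sum_distrib_left)
  also have "\<dots> = (\<Sum>x\<in>words k n. of_bool (x \<in> fixed_words k n g) / real (card (fixed_words k n g)))"
    by (intro sum.cong refl) (simp only: stab mult_1_right)
  also have "\<dots> = (\<Sum>x\<in>{x \<in> words k n. x \<in> fixed_words k n g}. 1 / real (card (fixed_words k n g)))"
    unfolding sum.inter_filter[OF finite_words] by (intro sum.cong) auto
  also have "{x \<in> words k n. x \<in> fixed_words k n g} = fixed_words k n g"
    by (auto simp: fixed_words_def)
  finally show ?thesis using card_fixed_words_pos[OF assms(2), of n] by simp
qed

text \<open>Burnside's orbit count: pairs (g, x) with g fixing x are counted in two ways. Grouping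
  the words by number m of symbols gives k! S(n,m), since C(k,m) m! (k-m)! = k!.\<close>

lemma sum_card_fixed_words:
  assumes "n \<ge> 1"
  shows "(\<Sum>g\<in>sym_grp_star k. real (card (fix_set k g)) ^ n) = fact k * real (Z_norm k n)"
proof -
  have "(\<Sum>g\<in>sym_grp_star k. real (card (fix_set k g)) ^ n)
      = (\<Sum>g\<in>sym_grp_star k. \<Sum>x\<in>words k n. of_bool (x \<in> fixed_words k n g))"
  proof (intro sum.cong refl)
    fix g
    have "{x \<in> words k n. x \<in> fixed_words k n g} = fixed_words k n g"
      by (auto simp: fixed_words_def)
    then show "real (card (fix_set k g)) ^ n = (\<Sum>x\<in>words k n. of_bool (x \<in> fixed_words k n g))"
      using finite_words[of k n] by (simp add: card_fixed_words Int_def)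
  qed
  also have "\<dots> = (\<Sum>x\<in>words k n. \<Sum>g\<in>sym_grp_star k. of_bool (x \<in> fixed_words k n g))"
    by (rule sum.swap)
  also have "\<dots> = (\<Sum>x\<in>words k n. fact (k - card (set x)))"
  proof (intro sum.cong refl)
    fix x assume x: "x \<in> words k n"
    have "(\<Sum>g\<in>sym_grp_star k. of_bool (x \<in> fixed_words k n g)) = real (card (stabilizer k x))"
      using finite_sym_grp_star[of k] by (simp add: stabilizer_eq[OF assms x] Int_def)
    then show "(\<Sum>g\<in>sym_grp_star k. of_bool (x \<in> fixed_words k n g)) = (fact (k - card (set x)) :: real)"
      by (simp add: card_stabilizer[OF x])
  qed
  also have "words k n = {x. set x \<subseteq> {1..k} \<and> length x = n}"
    by (auto simp: words_def)
  also have "(\<Sum>x\<in>{x. set x \<subseteq> {1..k} \<and> length x = n}. fact (k - card (set x)))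
      = (\<Sum>m\<le>k. real (k choose m) * real (Stirling n m) * fact m * fact (k - m))"
    using sum_over_words[of "{1..k}" "\<lambda>m. fact (k - m)" n] by simp
  also have "\<dots> = (\<Sum>m\<le>k. fact k * real (Stirling n m))"
    by (intro sum.cong refl) (simp add: binomial_fact)
  also have "\<dots> = (\<Sum>m=0..min k n. fact k * real (Stirling n m))"
    by (intro sum.mono_neutral_right) (auto simp: not_le)
  finally show ?thesis by (simp add: Z_norm_def sum_distrib_left)
qed

lemma Z_norm_pos:
  assumes "k \<ge> 1" "n \<ge> 1"
  shows "Z_norm k n > 0"
proof -
  obtain n' where "n = Suc n'" using assms(2) by (cases n) auto
  then have "Stirling n 1 = 1" by (simp only: One_nat_def Stirling_1)
  moreover have "Stirling n 1 \<le> Z_norm k n"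
    unfolding Z_norm_def using assms by (intro member_le_sum) auto
  ultimately show ?thesis by simp
qed

lemma fs_kernel_eq_density:
  assumes "S \<in> fs_index k" "T \<in> fs_index k"
  shows "fs_kernel k n S T = real (derangements (k - card T)) * fs_density k n S T"
proof -
  interpret block_kernel "sym_grp_star k" "dual_kernel k n" "fix_set k" "fs_index k" "fs_density k n"
    by (rule block_kernel_dual)
  show ?thesis
    using L_eq[OF assms(1), of T] by (simp add: fs_kernel_def fs_block_def flip: card_fs_block[OF assms(2)])
qed

lemma fs_law_eq:
  assumes "S \<in> fs_index k"
  shows "fs_law k n S = real (derangements (k - card S)) * real (card S) ^ n / (fact k * real (Z_norm k n))"
proof -
  have "fs_law k n S = (\<Sum>g\<in>fs_block k S. real (card S) ^ n / (fact k * real (Z_norm k n)))"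
    unfolding fs_law_def by (intro sum.cong) (auto simp: fs_block_def dual_law_def)
  then show ?thesis by (simp add: card_fs_block[OF assms])
qed

lemma fs_density_nonneg: "0 \<le> fs_density k n S T"
  unfolding fs_density_def by (intro mult_nonneg_nonneg sum_nonneg) auto

lemma fs_density_pos:
  assumes "finite S" "S \<inter> T \<noteq> {}"
  shows "0 < fs_density k n S T"
proof -
  obtain a where a: "a \<in> S \<inter> T" using assms by blast
  have "finite {x. set x \<subseteq> S \<inter> T \<and> length x = n}"
    using assms(1) by (intro finite_lists_length_eq) auto
  moreover have "replicate n a \<in> {x. set x \<subseteq> S \<inter> T \<and> length x = n}"
    using a by (auto simp: set_replicate_conv_if)
  ultimately have "(\<Sum>x\<in>{x. set x \<subseteq> S \<inter> T \<and> length x = n}. 1 / fact (k - card (set x))) > (0 :: real)"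
    by (intro sum_pos) auto
  moreover have "card S > 0" using assms a by (auto simp: card_gt_0_iff)
  ultimately show ?thesis by (simp add: fs_density_def)
qed

text \<open>Without the factor 1/|S|^n the density is a sum over words in the intersection, hence
  symmetric. This is the source of detailed balance for the lumped chain.\<close>

lemma fs_density_reversible:
  assumes "card S > 0" "card T > 0"
  shows "real (card S) ^ n * fs_density k n S T = real (card T) ^ n * fs_density k n T S"
  using assms by (simp add: fs_density_def Int_commute)

lemma fs_kernel_row_sum:
  assumes "n \<ge> 1" "S \<in> fs_index k"
  shows "(\<Sum>T\<in>fs_index k. fs_kernel k n S T) = 1"
proof -
  interpret block_kernel "sym_grp_star k" "dual_kernel k n" "fix_set k" "fs_index k" "fs_density k n"
    by (rule block_kernel_dual)
  obtain g where g: "g \<in> sym_grp_star k" "fix_set k g = S"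
    using assms(2) unfolding fix_set_image[symmetric] by blast
  have "(\<Sum>T\<in>fs_index k. fs_kernel k n S T) = (\<Sum>T\<in>fs_index k. \<Sum>h\<in>block T. dual_kernel k n g h)"
    by (intro sum.cong refl) (simp add: sum_block_P[OF g(1)] g(2) fs_kernel_def fs_block_def)
  also have "\<dots> = (\<Sum>h\<in>sym_grp_star k. dual_kernel k n g h)"
    by (rule sum_blocks[symmetric])
  finally show ?thesis using dual_kernel_row_sum[OF assms(1) g(1)] by simp
qed

lemma fs_law_stationary:
  assumes "k \<ge> 1" "n \<ge> 1"
  shows "stationary_law (fs_index k) (fs_kernel k n) (fs_law k n)"
  unfolding stationary_law_def
proof (intro conjI ballI)
  interpret block_kernel "sym_grp_star k" "dual_kernel k n" "fix_set k" "fs_index k" "fs_density k n"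
    by (rule block_kernel_dual)
  show "0 \<le> fs_law k n S" if "S \<in> fs_index k" for S
    by (simp add: fs_law_eq[OF that])
  have "(\<Sum>S\<in>fs_index k. fs_law k n S) = (\<Sum>g\<in>sym_grp_star k. dual_law k n g)"
    by (subst sum_blocks) (simp add: fs_law_def fs_block_def)
  also have "\<dots> = 1"
    unfolding dual_law_def using Z_norm_pos[OF assms]
    by (simp add: sum_card_fixed_words[OF assms(2)] flip: sum_divide_distrib)
  finally show "(\<Sum>S\<in>fs_index k. fs_law k n S) = 1" .
  fix T assume T: "T \<in> fs_index k"
  \<comment> \<open>Detailed balance: the derangement numbers from the law and from the kernel
    appear on both sides. Summation over \<open>S\<close> then reduces stationarity to a row
    sum.\<close>
  have "fs_law k n S * fs_kernel k n S T = fs_law k n T * fs_kernel k n T S" if S: "S \<in> fs_index k" for S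
  proof -
    have "real (card S) ^ n * fs_density k n S T = real (card T) ^ n * fs_density k n T S"
      using fs_indexD[OF S] fs_indexD[OF T] by (intro fs_density_reversible) auto
    then show ?thesis
      by (simp add: fs_law_eq fs_kernel_eq_density S T mult_ac)
  qed
  then have "(\<Sum>S\<in>fs_index k. fs_law k n S * fs_kernel k n S T)
      = fs_law k n T * (\<Sum>S\<in>fs_index k. fs_kernel k n T S)"
    by (simp add: sum_distrib_left)
  then show "(\<Sum>S\<in>fs_index k. fs_law k n S * fs_kernel k n S T) = fs_law k n T"
    by (simp add: fs_kernel_row_sum[OF assms(2) T])
qed

lemma stationary_law_fs_kernel_iff:
  assumes "k \<ge> 2" "n \<ge> 1"
  shows "stationary_law (fs_index k) (fs_kernel k n) \<mu> \<longleftrightarrow> (\<forall>S\<in>fs_index k. \<mu> S = fs_law k n S)"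
proof
  have fin: "finite (fs_index k)"
    using finite_sym_grp_star[of k] by (simp flip: fix_set_image)
  have law: "stationary_law (fs_index k) (fs_kernel k n) (fs_law k n)"
    using assms by (intro fs_law_stationary) auto
  \<comment> \<open>The full symbol set, whose block is the identity alone, meets every nonempty
    \<open>S\<close>. Its column is therefore positive and serves as the common column for
    uniqueness.\<close>
  have full: "{1..k} \<in> fs_index k"
    using assms by (auto simp: fs_index_def)
  {
    assume "stationary_law (fs_index k) (fs_kernel k n) \<mu>"
    then show "\<forall>S\<in>fs_index k. \<mu> S = fs_law k n S"
    proof (intro ballI stationary_law_unique[OF fin _ _ full _ _ law])
      show "0 \<le> fs_kernel k n S T" if "S \<in> fs_index k" "T \<in> fs_index k" for S T
        by (simp add: fs_kernel_eq_density that fs_density_nonneg)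
      show "(\<Sum>T\<in>fs_index k. fs_kernel k n S T) = 1" if "S \<in> fs_index k" for S
        by (rule fs_kernel_row_sum[OF assms(2) that])
      show "0 < fs_kernel k n S {1..k}" if S: "S \<in> fs_index k" for S
      proof -
        have "S \<inter> {1..k} \<noteq> {}" using S by (auto simp: fs_index_def)
        then have "0 < fs_density k n S {1..k}"
          using fs_indexD(2)[OF S] by (rule fs_density_pos[rotated])
        then show ?thesis
          by (simp add: fs_kernel_eq_density[OF S full] derangements_pos del: One_nat_def)
      qed
    qed
  }
  {
    assume "\<forall>S\<in>fs_index k. \<mu> S = fs_law k n S"
    with law show "stationary_law (fs_index k) (fs_kernel k n) \<mu>"
      by (simp add: stationary_law_def cong: sum.cong)
  }
qed

section \<open>Explicit entries of the lumped kernel\<close>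

lemma fs_kernel_Stirling:
  assumes "n \<ge> 1" "S \<in> fs_index k" "T \<in> fs_index k"
  shows "fs_kernel k n S T = real (derangements (k - card T)) * (1 / real (card S) ^ n) *
    (\<Sum>m=1..min (card (S \<inter> T)) n. real (card (S \<inter> T) choose m) * real (Stirling n m) * (fact m / fact (k - m)))"
  using fs_indexD(2)[OF assms(2)]
    sum_choose_Stirling_restrict[OF assms(1), of "card (S \<inter> T)" "\<lambda>m. fact m / fact (k - m)"]
  by (simp add: fs_kernel_eq_density assms fs_density_eq_Stirling_sum)

lemma fs_kernel_expectation:
  assumes "n \<ge> 1" "S \<in> fs_index k" "T \<in> fs_index k" "j = card (S \<inter> T)"
  shows "fs_kernel k n S T = (if j = 0 then 0
    else real (derangements (k - card T)) * (real j / real (card S)) ^ n *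
      measure_pmf.expectation (pmf_of_set (words j n)) (\<lambda>w. 1 / fact (k - card (set w))))"
proof (cases "j = 0")
  case True
  then show ?thesis
    using assms by (simp add: fs_kernel_Stirling)
next
  case False
  then have "j \<ge> 1" by simp
  \<comment> \<open>The j^n in (j/|S|)^n cancels the number of words, by which the expectation
    divides.\<close>
  from expectation_words[OF this] False show ?thesis
    using assms fs_indexD(2)[OF assms(2)]
    by (simp add: fs_kernel_eq_density fs_density_eq_Stirling_sum power_divide)
qed

lemma fs_kernel_gf:
  assumes "n \<ge> 1" "S \<in> fs_index k" "T \<in> fs_index k" "j = card (S \<inter> T)"
  shows "fs_kernel k n S T = real (derangements (k - card T)) * (fact n / real (card S) ^ n) *
    fps_nth (fps_nth (fs_gf j) k) n"
proof -
  have "j \<le> card S"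
    using assms(4) fs_indexD(2)[OF assms(2)] by (simp add: card_mono)
  also have "card S \<le> k" using fs_indexD(1)[OF assms(2)] .
  finally have j: "j \<le> k" .
  show ?thesis
    unfolding fs_gf_nth[OF j]
    using assms fs_indexD(2)[OF assms(2)]
    by (simp add: fs_kernel_eq_density fs_density_eq_Stirling_sum sum_distrib_left mult_ac)
qed

theorem corollary4p8:
  fixes k n :: nat
  assumes "k \<ge> 2" and "n \<ge> 1"
  shows
    "card (fs_index k) = 2 ^ k - k - 1
     \<and> strongly_lumpable (sym_grp_star k) (dual_kernel k n) (fs_block k ` fs_index k)
     \<and> (\<forall>S\<in>fs_index k. \<forall>T\<in>fs_index k. \<forall>j. j = card (S \<inter> T) \<longrightarrow>
          fs_kernel k n S T =
            real (derangements (k - card T)) * (1 / real (card S) ^ n) *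
              (\<Sum>m=1..min j n. real (j choose m) * real (Stirling n m) * (fact m / fact (k - m)))
        \<and> fs_kernel k n S T =
            (if j = 0 then 0
             else real (derangements (k - card T)) * (real j / real (card S)) ^ n *
               measure_pmf.expectation (pmf_of_set (words j n))
                 (\<lambda>w. 1 / fact (k - card (set w))))
        \<and> fs_kernel k n S T =
            real (derangements (k - card T)) * (fact n / real (card S) ^ n) *
              fps_nth (fps_nth (fs_gf j) k) n)
     \<and> (\<forall>S\<in>fs_index k. fs_law k n S =
          real (derangements (k - card S)) * real (card S) ^ n / (fact k * real (Z_norm k n)))
     \<and> (\<forall>\<mu>. stationary_law (fs_index k) (fs_kernel k n) \<mu> \<longleftrightarrow>
          (\<forall>S\<in>fs_index k. \<mu> S = fs_law k n S))
     \<and> spec_nz (kernel_cmat (words k n) (burnside_kernel k n)) =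
         spec_nz (kernel_cmat (sym_grp_star k) (dual_kernel k n))
     \<and> spec_nz (kernel_cmat (sym_grp_star k) (dual_kernel k n)) =
         spec_nz (kernel_cmat (fs_index k) (fs_kernel k n))
     \<and> (\<forall>z. z \<noteq> 0 \<longrightarrow>
          alg_mult (kernel_cmat (words k n) (burnside_kernel k n)) z =
            alg_mult (kernel_cmat (sym_grp_star k) (dual_kernel k n)) z
        \<and> alg_mult (kernel_cmat (sym_grp_star k) (dual_kernel k n)) z =
            alg_mult (kernel_cmat (fs_index k) (fs_kernel k n)) z)
     \<and> mat_rank (kernel_mat (words k n) (burnside_kernel k n)) =
         mat_rank (kernel_mat (sym_grp_star k) (dual_kernel k n))
     \<and> mat_rank (kernel_mat (sym_grp_star k) (dual_kernel k n)) \<le> 2 ^ k - k - 1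
     \<and> (\<forall>z :: complex.
          Determinant.det (z \<cdot>\<^sub>m 1\<^sub>m (card (sym_grp_star k))
            - kernel_cmat (sym_grp_star k) (dual_kernel k n)) =
          z ^ (card (sym_grp_star k) - card (fs_index k)) *
          Determinant.det (z \<cdot>\<^sub>m 1\<^sub>m (card (fs_index k))
            - kernel_cmat (fs_index k) (fs_kernel k n)))
     \<and> (\<forall>t\<ge>1.
          (\<forall>S\<in>fs_index k. \<forall>g\<in>fs_block k S.
             mix_dist (sym_grp_star k) (dual_kernel k n) (dual_law k n) g t =
             mix_dist (fs_index k) (fs_kernel k n) (fs_law k n) S t)
        \<and> max_mix_dist (sym_grp_star k) (dual_kernel k n) (dual_law k n) t =
            (MAX S\<in>fs_index k. mix_dist (fs_index k) (fs_kernel k n) (fs_law k n) S t))"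
proof -
  let ?G = "sym_grp_star k" and ?I = "fs_index k" and ?Q = "dual_kernel k n"
  interpret B: block_kernel ?G ?Q "fix_set k" ?I "fs_density k n"
    by (rule block_kernel_dual)
  have L: "B.L = fs_kernel k n"
    by (simp add: fun_eq_iff fs_kernel_def fs_block_def)
  have law: "(\<lambda>S. \<Sum>g\<in>B.block S. dual_law k n g) = fs_law k n"
    by (simp add: fun_eq_iff fs_law_def fs_block_def)
  interpret KQ: kernel_factorization "words k n" ?G "burnside_kernel k n" ?Q
    "\<lambda>x g. of_bool (x \<in> fixed_words k n g) / real (card (stabilizer k x))"
    "\<lambda>g x. of_bool (x \<in> fixed_words k n g) / real (card (fixed_words k n g))"
    by (rule kernel_factorization_burnside[OF assms(2)])
  \<comment> \<open>The dual kernel is the second kernel of \<open>KQ\<close> and the first of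
    \<open>QL\<close>; the two exchanges chain into the comparison of all three kernels.\<close>
  interpret QL: kernel_factorization ?G ?I ?Q "fs_kernel k n"
    "\<lambda>s S. of_bool (fix_set k s = S)" "\<lambda>S t. fs_density k n S (fix_set k t)"
    using B.factorization unfolding L .
  have card_I: "card ?I = 2 ^ k - k - 1"
    using assms(1) by (rule card_fs_index)
  have card_le: "card ?I \<le> card ?G"
    unfolding fix_set_image[symmetric] by (rule card_image_le[OF finite_sym_grp_star])
  have lumpable: "strongly_lumpable ?G ?Q (fs_block k ` ?I)"
    using B.strongly_lumpable by (simp add: fs_block_def[abs_def])
  have rank: "mat_rank (kernel_mat (words k n) (burnside_kernel k n)) = mat_rank (kernel_mat ?G ?Q)"
    \<comment> \<open>With these weights both half-steps become the same 0/1 incidence of words and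
      permutations.\<close>
    by (rule KQ.mat_rank_eq[where \<alpha> = "\<lambda>x. real (card (stabilizer k x))"
          and \<beta> = "\<lambda>g. real (card (fixed_words k n g))"])
       (use card_stabilizer_pos card_fixed_words_pos in force)+
  have mix: "mix_dist ?G ?Q (dual_law k n) g t = mix_dist ?I (fs_kernel k n) (fs_law k n) (fix_set k g) t"
    if "t \<ge> 1" "g \<in> ?G" for g t
    using B.mix_dist_eq[OF that, of "dual_law k n"] unfolding L law by (simp add: dual_law_def)
  have max_mix: "max_mix_dist ?G ?Q (dual_law k n) t
      = (MAX S\<in>?I. mix_dist ?I (fs_kernel k n) (fs_law k n) S t)" if "t \<ge> 1" for t
  proof -
    \<comment> \<open>The distance depends on \<open>g\<close> only through its fixed set, and these
      sets range over exactly \<open>fs_index k\<close>, so the two maxima are over the same set of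
      values.\<close>
    have "(\<lambda>g. mix_dist ?G ?Q (dual_law k n) g t) ` ?G
        = (\<lambda>S. mix_dist ?I (fs_kernel k n) (fs_law k n) S t) ` fix_set k ` ?G"
      unfolding image_image by (intro image_cong refl mix that)
    then show ?thesis by (simp add: max_mix_dist_def fix_set_image)
  qed
  show ?thesis
  proof (intro conjI allI ballI impI)
    fix S T j assume ST: "S \<in> ?I" "T \<in> ?I" and j: "j = card (S \<inter> T)"
    show "fs_kernel k n S T = real (derangements (k - card T)) * (1 / real (card S) ^ n) *
        (\<Sum>m=1..min j n. real (j choose m) * real (Stirling n m) * (fact m / fact (k - m)))"
      unfolding j by (rule fs_kernel_Stirling[OF assms(2) ST])
    show "fs_kernel k n S T = (if j = 0 then 0
        else real (derangements (k - card T)) * (real j / real (card S)) ^ n *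
          measure_pmf.expectation (pmf_of_set (words j n)) (\<lambda>w. 1 / fact (k - card (set w))))"
      by (rule fs_kernel_expectation[OF assms(2) ST j])
    show "fs_kernel k n S T = real (derangements (k - card T)) * (fact n / real (card S) ^ n) *
        fps_nth (fps_nth (fs_gf j) k) n"
      by (rule fs_kernel_gf[OF assms(2) ST j])
  next
    fix t :: nat and S g assume "1 \<le> t" "S \<in> ?I" "g \<in> fs_block k S"
    then show "mix_dist ?G ?Q (dual_law k n) g t = mix_dist ?I (fs_kernel k n) (fs_law k n) S t"
      using mix[of t g] by (simp add: fs_block_def)
  qed (fact card_I lumpable KQ.spec_nz_eq QL.spec_nz_eq rank max_mix fs_law_eq
        stationary_law_fs_kernel_iff[OF assms] KQ.alg_mult_eq QL.alg_mult_eq QL.det_eq[OF card_le]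
        QL.mat_rank_le[unfolded card_I])+
qed

end
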